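(* The algebra $\mathrm{S}(W_+)$ satisfies the ascending chain condition on radical Poisson ideals: for every ascending sequence $I_1\subseteq I_2\subseteq I_3\subseteq\cdots$ of radical Poisson ideals of $\mathrm{S}(W_+)$ there is $N$ such that $I_j=I_N$ for all $j\geq N$.
   Context: $\Bbbk$ is a field of characteristic zero. The positive Witt algebra $W_+$ is the Lie algebra over $\Bbbk$ with basis $\{e_n : n\in\mathbb{Z}_{\geq 1}\}$ and bracket $[e_i,e_j]=(j-i)e_{i+j}$. Its symmetric algebra $\mathrm{S}(W_+)$ is the polynomial ring $\Bbbk[x_1,x_2,\dots]$ ($x_i$ being the image of $e_i$), with the Poisson bracket determined by $\{x_i,x_j\}=(j-i)x_{i+j}$ and the Leibniz rule. A Poisson ideal is an ideal $I$ with $\{f,g\}\in I$ for all $f\in I$, $g\in\mathrm{S}(W_+)$. An ideal $I$ is radical if $I=\sqrt I$. *)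

theory Defs
  imports "HOL-Library.Poly_Mapping"
begin

text \<open>
  The polynomial ring in the variables \<open>x\<^sub>1, x\<^sub>2, \<dots>\<close>: a monomial is a finitely supported
  exponent vector, a polynomial a finitely supported family of coefficients, and the
  product is convolution. Position \<open>i\<close> of an exponent vector belongs to \<open>x\<^sub>i\<^sub>+\<^sub>1\<close>, so the
  positions \<open>0, 1, 2, \<dots>\<close> exhaust the variables.
\<close>
type_synonym 'k sym_witt = "(nat \<Rightarrow>\<^sub>0 nat) \<Rightarrow>\<^sub>0 'k"

definition cst :: "'k \<Rightarrow> 'k::comm_ring_1 sym_witt" where
  "cst c = Poly_Mapping.single 0 c"

text \<open>The variable \<open>x\<^sub>n\<close>, for \<open>n \<ge> 1\<close>; the term \<open>var 0\<close> is junk and is never used.\<close>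
definition var :: "nat \<Rightarrow> 'k::comm_ring_1 sym_witt" where
  "var n = Poly_Mapping.single (Poly_Mapping.single (n - 1) 1) 1"

definition is_poisson_bracket ::
  "('k::comm_ring_1 sym_witt \<Rightarrow> 'k sym_witt \<Rightarrow> 'k sym_witt) \<Rightarrow> bool" where
  "is_poisson_bracket B \<longleftrightarrow>
     (\<forall>f g h. B (f + g) h = B f h + B g h) \<and>
     (\<forall>f g h. B f (g + h) = B f g + B f h) \<and>
     (\<forall>c f g. B (cst c * f) g = cst c * B f g) \<and>
     (\<forall>c f g. B f (cst c * g) = cst c * B f g) \<and>
     (\<forall>f. B f f = 0) \<and>
     (\<forall>f g h. B f (B g h) + B g (B h f) + B h (B f g) = 0) \<and>
     (\<forall>f g h. B f (g * h) = B f g * h + g * B f h)"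

definition extends_witt_bracket ::
  "('k::comm_ring_1 sym_witt \<Rightarrow> 'k sym_witt \<Rightarrow> 'k sym_witt) \<Rightarrow> bool" where
  "extends_witt_bracket B \<longleftrightarrow>
     (\<forall>i\<ge>1. \<forall>j\<ge>1. B (var i) (var j) = of_int (int j - int i) * var (i + j))"

text \<open>Existence and uniqueness are proved at the end of this theory.\<close>
definition witt_bracket ::
  "'k::field_char_0 sym_witt \<Rightarrow> 'k sym_witt \<Rightarrow> 'k sym_witt" where
  "witt_bracket = (THE B. is_poisson_bracket B \<and> extends_witt_bracket B)"

definition is_ideal :: "'a::comm_ring_1 set \<Rightarrow> bool" where
  "is_ideal I \<longleftrightarrow>
     0 \<in> I \<and> (\<forall>f\<in>I. \<forall>g\<in>I. f + g \<in> I) \<and> (\<forall>r. \<forall>f\<in>I. r * f \<in> I)"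

definition ideal_radical :: "'a::comm_ring_1 set \<Rightarrow> 'a set" where
  "ideal_radical I = {f. \<exists>n\<ge>1. f ^ n \<in> I}"

definition is_radical_ideal :: "'a::comm_ring_1 set \<Rightarrow> bool" where
  "is_radical_ideal I \<longleftrightarrow> is_ideal I \<and> I = ideal_radical I"

definition is_poisson_ideal :: "'k::field_char_0 sym_witt set \<Rightarrow> bool" where
  "is_poisson_ideal I \<longleftrightarrow> is_ideal I \<and> (\<forall>f\<in>I. \<forall>g. witt_bracket f g \<in> I)"


subsection \<open>The bracket is well defined\<close>

lemma cst_mult_cst: "cst a * cst b = cst (a * b)"
  by (simp add: cst_def mult_single)

lemma cst_one: "cst 1 = 1"
  by (simp add: cst_def)

lemma of_int_eq_cst: "of_int n = cst (of_int n)"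
  by (simp add: cst_def)

lemma sym_witt_induct [case_names cst var add mult]:
  fixes f :: "'k::comm_ring_1 sym_witt"
  assumes C: "\<And>c. P (cst c)"
    and V: "\<And>i. i \<ge> 1 \<Longrightarrow> P (var i)"
    and A: "\<And>f g. P f \<Longrightarrow> P g \<Longrightarrow> P (f + g)"
    and M: "\<And>f g. P f \<Longrightarrow> P g \<Longrightarrow> P (f * g)"
  shows "P f"
proof -
  let ?m = "\<lambda>m. Poly_Mapping.single m (1::'k) :: 'k sym_witt"
  have mm: "?m (a + b) = ?m a * ?m b" for a b
    by (simp add: mult_single)
  have 1: "P (?m (Poly_Mapping.single i n))" for i n
  proof (induction n)
    case 0
    show ?case using C[of 1] by (simp add: cst_def)
  next
    case (Suc n)
    have "?m (Poly_Mapping.single i (Suc n))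
        = ?m (Poly_Mapping.single i n) * var (Suc i)"
      by (simp add: mult_single var_def flip: single_add)
    then show ?case using M[OF Suc V[of "Suc i"]] by simp
  qed
  have upd: "Poly_Mapping.update k v g = g + Poly_Mapping.single k v"
    if "k \<notin> Poly_Mapping.keys g" for k and v :: "'v::monoid_add" and g
    using that
    by (intro poly_mapping_eqI)
      (auto simp: lookup_update lookup_add lookup_single when_def in_keys_iff)
  have 2: "P (?m m)" for m
  proof (induction m rule: update_induct)
    case const
    show ?case using C[of 1] by (simp add: cst_def)
  next
    case (update g k v)
    then show ?case using M[OF _ 1] by (simp add: upd mm)
  qed
  have 3: "P (Poly_Mapping.single m c)" for m c
    using M[OF C[of c] 2[of m]] by (simp add: cst_def mult_single)
  show ?thesis
  proof (induction f rule: update_induct)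
    case const
    show ?case using C[of 0] by (simp add: cst_def)
  next
    case (update g k v)
    then show ?case using A[OF _ 3] by (simp add: upd)
  qed
qed

text \<open>The derivation sending the variable at position \<open>i\<close>, that is \<open>x\<^sub>i\<^sub>+\<^sub>1\<close>, to \<open>\<phi> i\<close>.\<close>

definition mon_deriv ::
  "(nat \<Rightarrow> 'k::comm_ring_1 sym_witt) \<Rightarrow> (nat \<Rightarrow>\<^sub>0 nat) \<Rightarrow> 'k sym_witt" where
  "mon_deriv \<phi> m = (\<Sum>i\<in>Poly_Mapping.keys m. of_nat (Poly_Mapping.lookup m i) *
     Poly_Mapping.single (m - Poly_Mapping.single i 1) 1 * \<phi> i)"

definition deriv_of ::
  "(nat \<Rightarrow> 'k::comm_ring_1 sym_witt) \<Rightarrow> 'k sym_witt \<Rightarrow> 'k sym_witt" where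
  "deriv_of \<phi> f =
     (\<Sum>m\<in>Poly_Mapping.keys f. cst (Poly_Mapping.lookup f m) * mon_deriv \<phi> m)"

lemma mon_deriv_superset:
  assumes "finite A" "Poly_Mapping.keys m \<subseteq> A"
  shows "mon_deriv \<phi> m = (\<Sum>i\<in>A. of_nat (Poly_Mapping.lookup m i) *
     Poly_Mapping.single (m - Poly_Mapping.single i 1) 1 * \<phi> i)"
  unfolding mon_deriv_def
  by (rule sum.mono_neutral_left) (use assms in \<open>auto simp: in_keys_iff\<close>)

lemma deriv_of_superset:
  assumes "finite A" "Poly_Mapping.keys f \<subseteq> A"
  shows "deriv_of \<phi> f = (\<Sum>m\<in>A. cst (Poly_Mapping.lookup f m) * mon_deriv \<phi> m)"
  unfolding deriv_of_def
  by (rule sum.mono_neutral_left) (use assms in \<open>auto simp: in_keys_iff cst_def\<close>)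

lemma cst_add: "cst (a + b) = cst a + cst b"
  by (simp add: cst_def single_add)

lemma deriv_of_add: "deriv_of \<phi> (f + g) = deriv_of \<phi> f + deriv_of \<phi> g"
proof -
  let ?A = "Poly_Mapping.keys f \<union> Poly_Mapping.keys g"
  have "finite ?A" by simp
  moreover have "Poly_Mapping.keys (f + g) \<subseteq> ?A"
    by (rule keys_add)
  ultimately show ?thesis
    by (simp add: deriv_of_superset[of ?A] lookup_add cst_add ring_distribs sum.distrib)
qed

lemma deriv_of_single:
  "deriv_of \<phi> (Poly_Mapping.single m c) = cst c * mon_deriv \<phi> m"
  by (subst deriv_of_superset[of "{m}"]) (auto split: if_splits)

lemma single_minus_add:
  fixes m n :: "nat \<Rightarrow>\<^sub>0 nat"
  assumes "Poly_Mapping.lookup n i > 0"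
  shows "m + n - Poly_Mapping.single i 1 = m + (n - Poly_Mapping.single i 1)"
  using assms
  by (intro poly_mapping_eqI) (auto simp: lookup_add lookup_minus lookup_single when_def)

lemma mon_deriv_add:
  fixes \<phi> :: "nat \<Rightarrow> 'k::comm_ring_1 sym_witt"
  shows "mon_deriv \<phi> (m + n) = Poly_Mapping.single m 1 * mon_deriv \<phi> n
     + Poly_Mapping.single n 1 * mon_deriv \<phi> m"
proof -
  let ?A = "Poly_Mapping.keys m \<union> Poly_Mapping.keys n"
  let ?s = "\<lambda>m. Poly_Mapping.single m (1::'k) :: 'k sym_witt"
  let ?e = "\<lambda>i. Poly_Mapping.single i (1::nat)"
  have fin: "finite ?A" by simp
  have half: "of_nat (Poly_Mapping.lookup n i) * ?s (m + n - ?e i) * \<phi> i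
      = ?s m * (of_nat (Poly_Mapping.lookup n i) * ?s (n - ?e i) * \<phi> i)" for m n i
  proof (cases "Poly_Mapping.lookup n i > 0")
    case True
    have "?s (m + n - ?e i) = ?s m * ?s (n - ?e i)"
      by (simp only: single_minus_add[OF True] mult_single) simp
    then show ?thesis by (simp only: mult_ac)
  qed simp
  have "mon_deriv \<phi> (m + n)
      = (\<Sum>i\<in>?A. of_nat (Poly_Mapping.lookup (m + n) i) * ?s (m + n - ?e i) * \<phi> i)"
    by (rule mon_deriv_superset[OF fin keys_add])
  also have "\<dots> = (\<Sum>i\<in>?A. of_nat (Poly_Mapping.lookup n i) * ?s (m + n - ?e i) * \<phi> i
      + of_nat (Poly_Mapping.lookup m i) * ?s (n + m - ?e i) * \<phi> i)"
    by (simp add: lookup_add ring_distribs add.commute)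
  also have "\<dots> = (\<Sum>i\<in>?A. ?s m * (of_nat (Poly_Mapping.lookup n i) * ?s (n - ?e i) * \<phi> i)
      + ?s n * (of_nat (Poly_Mapping.lookup m i) * ?s (m - ?e i) * \<phi> i))"
    by (simp only: half)
  also have "\<dots> = ?s m * mon_deriv \<phi> n + ?s n * mon_deriv \<phi> m"
    using mon_deriv_superset[OF fin, of n \<phi>] mon_deriv_superset[OF fin, of m \<phi>]
    by (simp add: sum.distrib sum_distrib_left)
  finally show ?thesis .
qed

lemma poly_single_induct [case_names zero add_single]:
  fixes f :: "'a \<Rightarrow>\<^sub>0 'b::monoid_add"
  assumes "P 0" and "\<And>f k v. P f \<Longrightarrow> P (f + Poly_Mapping.single k v)"
  shows "P f"
proof (induction f rule: update_induct)
  case const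
  show ?case by (rule assms(1))
next
  case (update g k v)
  have "Poly_Mapping.update k v g = g + Poly_Mapping.single k v"
    using update
    by (intro poly_mapping_eqI)
      (auto simp: lookup_update lookup_add lookup_single when_def in_keys_iff)
  then show ?case using assms(2)[OF update(3)] by simp
qed

lemma deriv_of_zero [simp]: "deriv_of \<phi> 0 = 0"
  by (simp add: deriv_of_def)

lemma deriv_of_mult:
  fixes f g :: "'k::comm_ring_1 sym_witt"
  shows "deriv_of \<phi> (f * g) = deriv_of \<phi> f * g + f * deriv_of \<phi> g"
proof -
  have ss: "deriv_of \<phi> (Poly_Mapping.single m a * Poly_Mapping.single n b)
      = deriv_of \<phi> (Poly_Mapping.single m a) * Poly_Mapping.single n b
        + Poly_Mapping.single m a * deriv_of \<phi> (Poly_Mapping.single n b)" for m n a b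
  proof -
    have s: "Poly_Mapping.single m a = cst a * Poly_Mapping.single m 1" for m and a :: 'k
      by (simp add: cst_def mult_single)
    have "deriv_of \<phi> (Poly_Mapping.single m a * Poly_Mapping.single n b)
        = cst a * cst b * (Poly_Mapping.single m 1 * mon_deriv \<phi> n
            + Poly_Mapping.single n 1 * mon_deriv \<phi> m)"
      by (simp add: mult_single deriv_of_single mon_deriv_add cst_mult_cst)
    then show ?thesis
      unfolding deriv_of_single by (subst s[of n b], subst s[of m a]) (simp add: algebra_simps)
  qed
  have sg: "deriv_of \<phi> (Poly_Mapping.single m a * g)
      = deriv_of \<phi> (Poly_Mapping.single m a) * g + Poly_Mapping.single m a * deriv_of \<phi> g"
    for m a
    by (induction g rule: poly_single_induct) (simp_all add: ring_distribs deriv_of_add ss)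
  show ?thesis
    by (induction f rule: poly_single_induct) (simp_all add: ring_distribs deriv_of_add sg)
qed

lemma deriv_of_cst: "deriv_of \<phi> (cst c) = 0"
  by (simp add: cst_def deriv_of_single mon_deriv_def)

lemma deriv_of_var: "deriv_of \<phi> (var i) = \<phi> (i - 1)"
  by (simp add: var_def deriv_of_single mon_deriv_def cst_def)

lemma deriv_of_fun_add: "deriv_of (\<lambda>i. \<phi> i + \<psi> i) f = deriv_of \<phi> f + deriv_of \<psi> f"
  by (simp add: deriv_of_def mon_deriv_def ring_distribs sum.distrib)

lemma deriv_of_fun_mult: "deriv_of (\<lambda>i. r * \<phi> i) f = r * deriv_of \<phi> f"
  by (simp add: deriv_of_def mon_deriv_def sum_distrib_left mult_ac)

definition witt_bracket_expl ::
  "'k::comm_ring_1 sym_witt \<Rightarrow> 'k sym_witt \<Rightarrow> 'k sym_witt" where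
  "witt_bracket_expl f g =
     deriv_of (\<lambda>i. deriv_of (\<lambda>j. of_int (int j - int i) * var (i + j + 2)) g) f"

context
begin

private abbreviation (input) B where "B \<equiv> witt_bracket_expl"

private lemma B_add1: "B (f + g) h = B f h + B g h"
  by (simp add: witt_bracket_expl_def deriv_of_add)

private lemma B_add2: "B f (g + h) = B f g + B f h"
  by (simp add: witt_bracket_expl_def deriv_of_add deriv_of_fun_add)

private lemma B_mult1: "B (f * g) h = B f h * g + f * B g h"
  by (simp add: witt_bracket_expl_def deriv_of_mult)

private lemma B_mult2: "B f (g * h) = B f g * h + g * B f h"
proof -
  let ?D = "\<lambda>g i. deriv_of (\<lambda>j. of_int (int j - int i) * var (i + j + 2)) g"
  have "B f (g * h) = deriv_of (\<lambda>i. h * ?D g i + g * ?D h i) f"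
    unfolding witt_bracket_expl_def deriv_of_mult by (simp only: mult.commute[of h])
  also have "\<dots> = h * B f g + g * B f h"
    unfolding witt_bracket_expl_def by (simp only: deriv_of_fun_add deriv_of_fun_mult)
  finally show ?thesis by (simp only: mult.commute)
qed

private lemma B_cst1: "B (cst c) g = 0"
  by (simp add: witt_bracket_expl_def deriv_of_cst)

private lemma B_cst2: "B f (cst c) = 0"
  using deriv_of_fun_mult[of 0 "\<lambda>_. 0" f] by (simp add: witt_bracket_expl_def deriv_of_cst)

private lemma B_var:
  assumes "i \<ge> 1" "j \<ge> 1"
  shows "B (var i) (var j) = of_int (int j - int i) * var (i + j)"
proof -
  have "int (j - 1) - int (i - 1) = int j - int i" "i - 1 + (j - 1) + 2 = i + j"
    using assms by auto
  then show ?thesis by (simp only: witt_bracket_expl_def deriv_of_var)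
qed

private lemma B_antisym: "B g f = - B f g"
proof (induction f rule: sym_witt_induct)
  case (var i)
  show ?case
  proof (induction g rule: sym_witt_induct)
    case (var j)
    then show ?case using \<open>i \<ge> 1\<close> by (simp add: B_var add.commute algebra_simps)
  qed (simp_all add: B_add1 B_add2 B_mult1 B_mult2 B_cst1 B_cst2)
qed (simp_all add: B_add1 B_add2 B_mult1 B_mult2 B_cst1 B_cst2)

private lemma B_scale1: "B (cst c * f) g = cst c * B f g"
  by (simp add: B_mult1 B_cst1)

private lemma B_scale2: "B f (cst c * g) = cst c * B f g"
  by (simp add: B_mult2 B_cst2)

private lemma B_of_int2: "B f (of_int n * g) = of_int n * B f g"
  by (simp add: of_int_eq_cst B_scale2)

private lemma B_zero2: "B f 0 = 0"
  using B_add2[of f 0 0] by simp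

private lemma B_zero1: "B 0 f = 0"
  using B_add1[of 0 0 f] by simp

private lemma B_minus2: "B f (- g) = - B f g"
  using B_add2[of f g "- g"] by (simp add: B_zero2 eq_neg_iff_add_eq_0 add.commute)

private lemma B_diff2: "B f (g - h) = B f g - B f h"
  using B_add2[of f g "- h"] by (simp add: B_minus2)

private definition J where "J f g h = B f (B g h) + B g (B h f) + B h (B f g)"

private lemma J_cyc: "J f g h = J g h f"
  by (simp add: J_def add_ac)

private lemma J_cst: "J (cst c) g h = 0"
  by (simp add: J_def B_cst1 B_cst2 B_zero2)

private lemma J_add: "J (f + f') g h = J f g h + J f' g h"
  by (simp add: J_def B_add1 B_add2 add_ac)

private lemma J_mult: "J (f * f') g h = J f g h * f' + f * J f' g h"
proof -
  have a: "B h f = - B f h" "B h f' = - B f' h" "B g f = - B f g" "B g f' = - B f' g"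
    by (rule B_antisym)+
  show ?thesis
    by (simp add: J_def B_mult1 B_mult2 B_add2 B_diff2 B_minus2 a algebra_simps)
qed

private lemma J_var:
  assumes "i \<ge> 1" "j \<ge> 1" "k \<ge> 1"
  shows "J (var i) (var j) (var k) = 0"
proof -
  have v: "B (var a) (B (var b) (var c))
      = of_int ((int c - int b) * (int b + int c - int a)) * var (i + j + k)"
    if "a \<ge> 1" "b \<ge> 1" "c \<ge> 1" "a + b + c = i + j + k" for a b c
  proof -
    have "B (var a) (B (var b) (var c))
        = of_int (int c - int b) * (of_int (int (b + c) - int a) * var (a + (b + c)))"
      using that by (simp only: B_var B_of_int2)
    also have "a + (b + c) = i + j + k" using that by simp
    finally show ?thesis by (simp add: mult.assoc)
  qed
  have "J (var i) (var j) (var k) = of_int ((int k - int j) * (int j + int k - int i)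
      + (int i - int k) * (int k + int i - int j)
      + (int j - int i) * (int i + int j - int k)) * var (i + j + k)"
    using assms by (simp only: J_def v[of i j k] v[of j k i] v[of k i j] add_ac
        of_int_add distrib_right)
  also have "(int k - int j) * (int j + int k - int i)
      + (int i - int k) * (int k + int i - int j)
      + (int j - int i) * (int i + int j - int k) = 0"
    by (simp add: algebra_simps)
  finally show ?thesis by simp
qed

private lemma J_zero: "J f g h = 0" for f :: "'k::comm_ring_1 sym_witt"
proof -
  have 1: "J f (var j) (var k) = 0" if "j \<ge> 1" "k \<ge> 1" for f :: "'k sym_witt" and j k
    by (induction f rule: sym_witt_induct)
      (simp_all add: J_cst J_add J_mult J_var that del: One_nat_def)
  have 2: "J g (var k) f = 0" if "k \<ge> 1" for f g :: "'k sym_witt" and k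
  proof (induction g rule: sym_witt_induct)
    case (var i)
    show ?case using 1[OF var that, of f] by (simp only: J_cyc[of f])
  qed (simp_all add: J_cst J_add J_mult)
  have "J h f g = 0"
  proof (induction h rule: sym_witt_induct)
    case (var i)
    show ?case using 2[OF var, of g f] by (simp only: J_cyc[of "var i" f g] J_cyc[of f g])
  qed (simp_all add: J_cst J_add J_mult)
  then show ?thesis by (simp only: J_cyc[of h f g])
qed

lemma witt_bracket_expl_poisson:
  "is_poisson_bracket (witt_bracket_expl :: 'k::field_char_0 sym_witt \<Rightarrow> _)"
proof -
  have "B f f = 0" for f :: "'k sym_witt"
  proof (rule poly_mapping_eqI)
    fix m
    have "Poly_Mapping.lookup (B f f) m = - Poly_Mapping.lookup (B f f) m"
      by (subst B_antisym) simp
    then have "2 * Poly_Mapping.lookup (B f f) m = 0" by simp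
    then show "Poly_Mapping.lookup (B f f) m = Poly_Mapping.lookup 0 m" by simp
  qed
  moreover have "B f (B g h) + B g (B h f) + B h (B f g) = 0" for f g h :: "'k sym_witt"
    using J_zero[of f g h] by (simp add: J_def)
  ultimately show ?thesis
    unfolding is_poisson_bracket_def
    by (intro conjI allI B_add1 B_add2 B_mult2 B_scale1 B_scale2) blast+
qed

lemma witt_bracket_expl_extends: "extends_witt_bracket witt_bracket_expl"
  by (simp add: extends_witt_bracket_def B_var)

end

lemma poisson_bracket_unique:
  fixes B C :: "'k::comm_ring_1 sym_witt \<Rightarrow> 'k sym_witt \<Rightarrow> 'k sym_witt"
  assumes "is_poisson_bracket B" "extends_witt_bracket B"
    and "is_poisson_bracket C" "extends_witt_bracket C"
  shows "B = C"
proof -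
  have cst2: "D f (cst c) = 0" if D: "is_poisson_bracket D"
    for D :: "'k sym_witt \<Rightarrow> 'k sym_witt \<Rightarrow> 'k sym_witt" and f c
  proof -
    have "D f (1 * 1) = D f 1 * 1 + 1 * D f 1"
      using D unfolding is_poisson_bracket_def by blast
    then have "D f 1 = 0" by simp
    moreover have "D f (cst c * 1) = cst c * D f 1"
      using D unfolding is_poisson_bracket_def by blast
    ultimately show ?thesis by simp
  qed
  have anti: "D g f = - D f g" if D: "is_poisson_bracket D"
    for D :: "'k sym_witt \<Rightarrow> 'k sym_witt \<Rightarrow> 'k sym_witt" and f g
  proof -
    have "D (f + g) (f + g) = D f f + D f g + (D g f + D g g)"
      using D unfolding is_poisson_bracket_def by metis
    moreover have "D (f + g) (f + g) = 0" "D f f = 0" "D g g = 0"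
      using D unfolding is_poisson_bracket_def by blast+
    ultimately show ?thesis by (simp add: eq_neg_iff_add_eq_0 add.commute)
  qed
  have step: "B f g = C f g" if "\<And>j. j \<ge> 1 \<Longrightarrow> B f (var j) = C f (var j)" for f g
  proof (induction g rule: sym_witt_induct)
    case (cst c)
    then show ?case using assms by (simp add: cst2)
  next
    case (var j)
    then show ?case by (rule that)
  next
    case (add g h)
    then show ?case using assms unfolding is_poisson_bracket_def by metis
  next
    case (mult g h)
    then show ?case using assms unfolding is_poisson_bracket_def by metis
  qed
  have "B (var i) g = C (var i) g" if "i \<ge> 1" for i g
    by (rule step) (use assms that in \<open>simp add: extends_witt_bracket_def\<close>)
  then have "B f (var j) = C f (var j)" if "j \<ge> 1" for f j
    using that anti[OF assms(1), of f "var j"] anti[OF assms(3), of f "var j"]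
    by metis
  then have "B f g = C f g" for f g by (rule step)
  then show ?thesis by (intro ext)
qed

theorem witt_bracket_ex1:
  "\<exists>!B :: 'k::field_char_0 sym_witt \<Rightarrow> _. is_poisson_bracket B \<and> extends_witt_bracket B"
proof (rule ex1I)
  show "is_poisson_bracket (witt_bracket_expl :: 'k sym_witt \<Rightarrow> _)
      \<and> extends_witt_bracket (witt_bracket_expl :: 'k sym_witt \<Rightarrow> _)"
    by (intro conjI witt_bracket_expl_poisson witt_bracket_expl_extends)
qed (elim conjE, rule poisson_bracket_unique[OF _ _ witt_bracket_expl_poisson
    witt_bracket_expl_extends])

corollary witt_bracket_eq_expl: "witt_bracket = witt_bracket_expl"
  unfolding witt_bracket_def
  by (rule the1_equality[OF witt_bracket_ex1])
    (intro conjI witt_bracket_expl_poisson witt_bracket_expl_extends)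

corollary witt_bracket_poisson: "is_poisson_bracket witt_bracket"
  unfolding witt_bracket_eq_expl by (rule witt_bracket_expl_poisson)

corollary witt_bracket_extends: "extends_witt_bracket witt_bracket"
  unfolding witt_bracket_eq_expl by (rule witt_bracket_expl_extends)

end

theory Submission
  imports Defs "HOL.Hull"
begin

text \<open>
  The argument follows Ritt and Raudenbush. If some radical Poisson ideal is not the radical
  Poisson hull of a finite set, Zorn's lemma gives a maximal such ideal \<open>P\<close>. An element
  \<open>f \<noteq> 0\<close> of \<open>P\<close> of least degree has a derivative \<open>s = \<partial>f / \<partial>x\<^sub>m \<notin> P\<close> with respect to its
  last variable \<open>x\<^sub>m\<close>. The brackets of \<open>f\<close> with \<open>x\<^sub>k\<close>, \<open>k > m\<close>, express \<open>s * x\<^sub>m\<^sub>+\<^sub>k\<close>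
  through lower variables, so modulo \<open>f\<close> and up to powers of \<open>s\<close> only finitely many variables
  matter, and Hilbert's basis theorem gives a finite \<open>F\<^sub>0 \<subseteq> P\<close> whose hull contains \<open>s * P\<close>.
  By maximality the hull of \<open>P\<close> and \<open>s\<close> is generated by \<open>s\<close> and a finite \<open>F\<^sub>1 \<subseteq> P\<close>; since
  colon ideals of radical Poisson ideals are again radical Poisson, \<open>p * p\<close> lies in the hull
  of \<open>F\<^sub>0 \<union> F\<^sub>1\<close> for every \<open>p \<in> P\<close>, so \<open>P\<close> is generated by \<open>F\<^sub>0 \<union> F\<^sub>1\<close> after all.
\<close>

section \<open>Hilbert's basis theorem for subrings\<close>

text \<open>Subrings are carrier sets in one ambient ring, not types, because the induction on the
  number of variables runs through a chain of subrings of the same polynomial ring.\<close>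

definition subring_set :: "'a::comm_ring_1 set \<Rightarrow> bool" where
  "subring_set A \<longleftrightarrow> 0 \<in> A \<and> 1 \<in> A \<and> (\<forall>a\<in>A. - a \<in> A)
     \<and> (\<forall>a\<in>A. \<forall>b\<in>A. a + b \<in> A) \<and> (\<forall>a\<in>A. \<forall>b\<in>A. a * b \<in> A)"

definition ideal_of_subring :: "'a::comm_ring_1 set \<Rightarrow> 'a set \<Rightarrow> bool" where
  "ideal_of_subring A I \<longleftrightarrow> I \<subseteq> A \<and> 0 \<in> I
     \<and> (\<forall>a\<in>I. \<forall>b\<in>I. a + b \<in> I) \<and> (\<forall>a\<in>A. \<forall>b\<in>I. a * b \<in> I)"

text \<open>Generation by \<open>H\<close> is expressed through minimality among ideals, which
  avoids finite linear combinations.\<close>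

definition noetherian_subring :: "'a::comm_ring_1 set \<Rightarrow> bool" where
  "noetherian_subring A \<longleftrightarrow> (\<forall>I. ideal_of_subring A I \<longrightarrow>
     (\<exists>H. finite H \<and> H \<subseteq> I \<and> (\<forall>K. ideal_of_subring A K \<and> H \<subseteq> K \<longrightarrow> I \<subseteq> K)))"

text \<open>These are the polynomial expressions in \<open>x\<close> of degree less than
  \<open>d\<close> with coefficients in \<open>A\<close>; the recursion splits off the term of
  degree \<open>d\<close>.\<close>

primrec polys_below :: "'a::comm_ring_1 set \<Rightarrow> 'a \<Rightarrow> nat \<Rightarrow> 'a set" where
  "polys_below A x 0 = {0}"
| "polys_below A x (Suc d) = {a * x ^ d + r |a r. a \<in> A \<and> r \<in> polys_below A x d}"

text \<open>
  The element \<open>x\<close> need not be transcendental over \<open>A\<close>, so a leading coefficient is that of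
  some representation, and \<open>a = 0\<close> is allowed.
\<close>

definition leading_coeffs :: "'a::comm_ring_1 set \<Rightarrow> 'a \<Rightarrow> 'a set \<Rightarrow> nat \<Rightarrow> 'a set" where
  "leading_coeffs A x I d = {a \<in> A. \<exists>r\<in>polys_below A x d. a * x ^ d + r \<in> I}"

lemma polys_below_zero: "subring_set A \<Longrightarrow> 0 \<in> polys_below A x d"
proof (induction d)
  case (Suc d)
  then have "0 \<in> A" "0 = 0 * x ^ d + 0" by (auto simp: subring_set_def)
  then show ?case using Suc by (simp only: polys_below.simps) blast
qed simp

lemma polys_below_add:
  assumes A: "subring_set A"
  shows "p \<in> polys_below A x d \<Longrightarrow> q \<in> polys_below A x d \<Longrightarrow> p + q \<in> polys_below A x d"
proof (induction d arbitrary: p q)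
  case (Suc d)
  then obtain a r b s where *: "p = a * x ^ d + r" "q = b * x ^ d + s" "a \<in> A" "b \<in> A"
    "r \<in> polys_below A x d" "s \<in> polys_below A x d" by auto
  then have "p + q = (a + b) * x ^ d + (r + s)" by (simp add: algebra_simps)
  moreover have "a + b \<in> A" using A * by (auto simp: subring_set_def)
  ultimately show ?case using Suc.IH * by (simp only: polys_below.simps) blast
qed simp

lemma polys_below_mult:
  assumes A: "subring_set A" and c: "c \<in> A"
  shows "p \<in> polys_below A x d \<Longrightarrow> c * p \<in> polys_below A x d"
proof (induction d arbitrary: p)
  case (Suc d)
  then obtain a r where *: "p = a * x ^ d + r" "a \<in> A" "r \<in> polys_below A x d" by auto
  then have "c * p = (c * a) * x ^ d + c * r" by (simp add: algebra_simps)
  moreover have "c * a \<in> A" using A c * by (auto simp: subring_set_def)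
  ultimately show ?case using Suc.IH * by (simp only: polys_below.simps) blast
qed simp

lemma polys_below_mult_var:
  assumes A: "subring_set A"
  shows "p \<in> polys_below A x d \<Longrightarrow> x * p \<in> polys_below A x (Suc d)"
proof (induction d arbitrary: p)
  case 0
  then show ?case using polys_below_zero[OF A, of x "Suc 0"] by simp
next
  case (Suc d)
  then obtain a r where *: "p = a * x ^ d + r" "a \<in> A" "r \<in> polys_below A x d" by auto
  then have "x * p = a * x ^ Suc d + x * r" by (simp add: algebra_simps)
  moreover have "x * r \<in> polys_below A x (Suc d)" using Suc.IH * by blast
  ultimately show ?case using * by (simp only: polys_below.simps(2)[of _ _ "Suc d"]) blast
qed

lemma polys_below_Suc: "subring_set A \<Longrightarrow> polys_below A x d \<subseteq> polys_below A x (Suc d)"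
proof
  fix p assume "subring_set A" "p \<in> polys_below A x d"
  moreover have "p = 0 * x ^ d + p" by simp
  ultimately show "p \<in> polys_below A x (Suc d)"
    unfolding polys_below.simps subring_set_def by blast
qed

lemma polys_below_mono: "subring_set A \<Longrightarrow> d \<le> e \<Longrightarrow> polys_below A x d \<subseteq> polys_below A x e"
  using lift_Suc_mono_le[of "polys_below A x"] polys_below_Suc by blast

lemma leading_coeffs_ideal:
  assumes A: "subring_set A" and B: "subring_set B" "A \<subseteq> B" and I: "ideal_of_subring B I"
  shows "ideal_of_subring A (leading_coeffs A x I d)"
  unfolding ideal_of_subring_def
proof (intro conjI ballI)
  show "leading_coeffs A x I d \<subseteq> A" by (auto simp: leading_coeffs_def)
  have "0 * x ^ d + 0 \<in> I" using I by (simp add: ideal_of_subring_def)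
  then show "0 \<in> leading_coeffs A x I d"
    using A polys_below_zero[OF A] unfolding leading_coeffs_def subring_set_def by blast
next
  fix a b assume "a \<in> leading_coeffs A x I d" "b \<in> leading_coeffs A x I d"
  then obtain r s where *: "a \<in> A" "b \<in> A" "r \<in> polys_below A x d" "s \<in> polys_below A x d"
    "a * x ^ d + r \<in> I" "b * x ^ d + s \<in> I" by (auto simp: leading_coeffs_def)
  then have "(a * x ^ d + r) + (b * x ^ d + s) \<in> I" using I by (auto simp: ideal_of_subring_def)
  then have "(a + b) * x ^ d + (r + s) \<in> I" by (simp add: algebra_simps)
  moreover have "a + b \<in> A" using A * by (auto simp: subring_set_def)
  ultimately show "a + b \<in> leading_coeffs A x I d"
    using polys_below_add[OF A] * unfolding leading_coeffs_def by blast
next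
  fix c a assume c: "c \<in> A" and "a \<in> leading_coeffs A x I d"
  then obtain r where *: "a \<in> A" "r \<in> polys_below A x d" "a * x ^ d + r \<in> I"
    by (auto simp: leading_coeffs_def)
  then have "c * (a * x ^ d + r) \<in> I" using I B c by (auto simp: ideal_of_subring_def)
  then have "(c * a) * x ^ d + c * r \<in> I" by (simp add: algebra_simps)
  moreover have "c * a \<in> A" using A c * by (auto simp: subring_set_def)
  ultimately show "c * a \<in> leading_coeffs A x I d"
    using polys_below_mult[OF A c] * unfolding leading_coeffs_def by blast
qed

text \<open>Multiplication by \<open>x\<close> stays in \<open>I\<close>, raises the degree by one
  and keeps the leading coefficient.\<close>

lemma leading_coeffs_mono:
  assumes A: "subring_set A" and I: "ideal_of_subring B I" and x: "x \<in> B" and "d \<le> e"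
  shows "leading_coeffs A x I d \<subseteq> leading_coeffs A x I e"
proof (rule lift_Suc_mono_le[of "leading_coeffs A x I", OF _ \<open>d \<le> e\<close>], rule subsetI)
  fix d a assume "a \<in> leading_coeffs A x I d"
  then obtain r where *: "a \<in> A" "r \<in> polys_below A x d" "a * x ^ d + r \<in> I"
    by (auto simp: leading_coeffs_def)
  then have "x * (a * x ^ d + r) \<in> I" using I x by (auto simp: ideal_of_subring_def)
  then have "a * x ^ Suc d + x * r \<in> I" by (simp add: algebra_simps)
  then show "a \<in> leading_coeffs A x I (Suc d)"
    using polys_below_mult_var[OF A] * unfolding leading_coeffs_def by blast
qed

text \<open>Induction on the degree bound: subtracting from \<open>p\<close> an element of
  \<open>K\<close> with the same leading coefficient lowers the degree, and the difference stays in
  \<open>I\<close> because \<open>K \<subseteq> I\<close>.\<close>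

lemma ideal_eq_if_leading_coeffs:
  assumes A: "subring_set A" and B: "subring_set B" "A \<subseteq> B" "x \<in> B"
    and I: "ideal_of_subring B I" and K: "ideal_of_subring B K" "K \<subseteq> I"
    and L: "\<And>d. leading_coeffs A x I d \<subseteq> leading_coeffs A x K d"
  shows "p \<in> I \<Longrightarrow> p \<in> polys_below A x d \<Longrightarrow> p \<in> K"
proof (induction d arbitrary: p)
  case 0
  then show ?case using K by (auto simp: ideal_of_subring_def)
next
  case (Suc d)
  then obtain a r where *: "p = a * x ^ d + r" "a \<in> A" "r \<in> polys_below A x d" by auto
  then have "a \<in> leading_coeffs A x I d" using Suc.prems by (auto simp: leading_coeffs_def)
  then obtain q where q: "q \<in> polys_below A x d" "a * x ^ d + q \<in> K"
    using L by (auto simp: leading_coeffs_def)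
  have m1: "- 1 \<in> A" using A by (auto simp: subring_set_def)
  have "p + - 1 * (a * x ^ d + q) \<in> I"
    using I K(2) Suc.prems(1) q(2) m1 B(2) unfolding ideal_of_subring_def by blast
  then have "r + - 1 * q \<in> I" using *(1) by simp
  moreover have "r + - 1 * q \<in> polys_below A x d"
    by (intro polys_below_add[OF A] polys_below_mult[OF A m1] * q)
  ultimately have "r + - 1 * q \<in> K" by (rule Suc.IH)
  then have "(r + - 1 * q) + (a * x ^ d + q) \<in> K"
    using K q(2) unfolding ideal_of_subring_def by blast
  then show ?case using *(1) by (simp add: algebra_simps)
qed

text \<open>The leading coefficient ideals of \<open>I\<close> increase with the degree, and their
  union is finitely generated, so they are constant from some degree \<open>D\<close> on. Lifting
  generators of the union in degree \<open>D\<close> and generators of each ideal up to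
  \<open>D\<close> gives finitely many generators of \<open>I\<close>.\<close>

theorem hilbert_basis_subring:
  assumes A: "subring_set A" "noetherian_subring A" and B: "subring_set B" "A \<subseteq> B" "x \<in> B"
    and gen: "B \<subseteq> (\<Union>d. polys_below A x d)"
  shows "noetherian_subring B"
  unfolding noetherian_subring_def
proof (intro allI impI)
  fix I assume I: "ideal_of_subring B I"
  let ?L = "leading_coeffs A x I"
  note L = leading_coeffs_ideal[OF A(1) B(1,2) I, of x]
  note Lm = leading_coeffs_mono[OF A(1) I B(3)]
  have "ideal_of_subring A (\<Union>d. ?L d)"
    unfolding ideal_of_subring_def
  proof (intro conjI ballI)
    show "(\<Union>d. ?L d) \<subseteq> A" "0 \<in> (\<Union>d. ?L d)"
      using L unfolding ideal_of_subring_def by blast+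
  next
    fix a b assume "a \<in> (\<Union>d. ?L d)" "b \<in> (\<Union>d. ?L d)"
    then obtain d e where "a \<in> ?L d" "b \<in> ?L e" by auto
    then have "a \<in> ?L (max d e)" "b \<in> ?L (max d e)"
      using Lm[of d "max d e"] Lm[of e "max d e"] by auto
    then have "a + b \<in> ?L (max d e)" using L[of "max d e"] by (simp add: ideal_of_subring_def)
    then show "a + b \<in> (\<Union>d. ?L d)" by blast
  next
    fix a b assume "a \<in> A" "b \<in> (\<Union>d. ?L d)"
    then obtain d where "b \<in> ?L d" by blast
    then have "a * b \<in> ?L d" using L[of d] \<open>a \<in> A\<close> by (simp add: ideal_of_subring_def)
    then show "a * b \<in> (\<Union>d. ?L d)" by blast
  qed
  then have "\<exists>H. finite H \<and> H \<subseteq> (\<Union>d. ?L d)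
      \<and> (\<forall>K. ideal_of_subring A K \<and> H \<subseteq> K \<longrightarrow> (\<Union>d. ?L d) \<subseteq> K)"
    using A(2) by (simp only: noetherian_subring_def)
  then obtain H where H': "finite H \<and> H \<subseteq> (\<Union>d. ?L d)
      \<and> (\<forall>K. ideal_of_subring A K \<and> H \<subseteq> K \<longrightarrow> (\<Union>d. ?L d) \<subseteq> K)" ..
  then have H: "finite H" "H \<subseteq> (\<Union>d. ?L d)"
    by simp_all
  from H' have H3: "(\<Union>d. ?L d) \<subseteq> K" if "ideal_of_subring A K" "H \<subseteq> K" for K
    using that by simp
  have "\<exists>D. H \<subseteq> ?L D"
    using H(1,2)
  proof (induction H rule: finite_induct)
    case (insert h H)
    then obtain D d where "H \<subseteq> ?L D" "h \<in> ?L d" by auto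
    then have "insert h H \<subseteq> ?L (max D d)"
      using Lm[of D "max D d"] Lm[of d "max D d"] by auto
    then show ?case by blast
  qed simp
  then obtain D where D: "H \<subseteq> ?L D" by blast
  have "\<exists>H. finite H \<and> H \<subseteq> ?L d \<and> (\<forall>K. ideal_of_subring A K \<and> H \<subseteq> K \<longrightarrow> ?L d \<subseteq> K)" for d
    using A(2) L[of d] by (simp only: noetherian_subring_def)
  then obtain Hd where Hd: "\<And>d. finite (Hd d)" "\<And>d. Hd d \<subseteq> ?L d"
    "\<And>d K. ideal_of_subring A K \<Longrightarrow> Hd d \<subseteq> K \<Longrightarrow> ?L d \<subseteq> K"
    by metis
  have "\<forall>d a. \<exists>g. a \<in> ?L d \<longrightarrow> g \<in> I \<and> (\<exists>r\<in>polys_below A x d. a * x ^ d + r = g)"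
    by (auto simp: leading_coeffs_def)
  then obtain g where g: "\<And>d a. a \<in> ?L d \<Longrightarrow> g d a \<in> I"
    "\<And>d a. a \<in> ?L d \<Longrightarrow> \<exists>r\<in>polys_below A x d. a * x ^ d + r = g d a"
    by metis
  define G where "G = g D ` H \<union> (\<Union>d\<in>{..D}. g d ` Hd d)"
  show "\<exists>G. finite G \<and> G \<subseteq> I \<and> (\<forall>K. ideal_of_subring B K \<and> G \<subseteq> K \<longrightarrow> I \<subseteq> K)"
  proof (intro exI[of _ G] conjI allI impI)
    show "finite G" using H(1) Hd(1) by (simp add: G_def)
    show GI: "G \<subseteq> I" using g(1) D Hd(2) by (fastforce simp: G_def)
    fix K assume K: "ideal_of_subring B K \<and> G \<subseteq> K"
    \<comment> \<open>The comparison by leading coefficients needs an ideal inside \<open>I\<close>,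
      hence the intersection.\<close>
    have KI: "ideal_of_subring B (K \<inter> I)"
      using K I by (auto simp: ideal_of_subring_def)
    note LK = leading_coeffs_ideal[OF A(1) B(1,2) KI, of x]
    have in_LK: "a \<in> leading_coeffs A x (K \<inter> I) d" if a: "a \<in> ?L d" "g d a \<in> G" for a d
    proof -
      obtain r where "r \<in> polys_below A x d" "a * x ^ d + r = g d a"
        using g(2) a(1) by blast
      moreover have "a \<in> A" "g d a \<in> K \<inter> I"
        using a K GI by (auto simp: leading_coeffs_def)
      ultimately show ?thesis
        unfolding leading_coeffs_def by (intro CollectI conjI bexI[of _ r]) simp_all
    qed
    have LL: "?L d \<subseteq> leading_coeffs A x (K \<inter> I) d" for d
    proof (cases "d \<le> D")
      case True
      then have "Hd d \<subseteq> leading_coeffs A x (K \<inter> I) d"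
        using in_LK Hd(2) by (fastforce simp: G_def)
      then show ?thesis by (rule Hd(3)[OF LK])
    next
      case False
      have "H \<subseteq> leading_coeffs A x (K \<inter> I) D"
        using in_LK D by (fastforce simp: G_def)
      then have "(\<Union>d. ?L d) \<subseteq> leading_coeffs A x (K \<inter> I) D" by (rule H3[OF LK])
      then show ?thesis using leading_coeffs_mono[OF A(1) KI B(3), of D d] False by auto
    qed
    show "I \<subseteq> K"
    proof
      fix p assume p: "p \<in> I"
      then have "p \<in> (\<Union>d. polys_below A x d)" using gen I by (auto simp: ideal_of_subring_def)
      then obtain d where d: "p \<in> polys_below A x d" by blast
      have "p \<in> K \<inter> I"
        by (rule ideal_eq_if_leading_coeffs[OF A(1) B I KI Int_lower2 LL p d])
      then show "p \<in> K" by blast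
    qed
  qed
qed

section \<open>Polynomials in finitely many variables\<close>

text \<open>Positions below \<open>M\<close> belong to x_1, ..., x_M, so this is the polynomial ring
  in the first \<open>M\<close> variables, and \<open>polys_upto 0\<close> consists of the
  constants.\<close>

definition polys_upto :: "nat \<Rightarrow> 'k::comm_ring_1 sym_witt set" where
  "polys_upto M = {f. \<forall>m\<in>Poly_Mapping.keys f. Poly_Mapping.keys m \<subseteq> {..<M}}"

lemma cst_in_polys_upto: "cst c \<in> polys_upto M"
  by (simp add: polys_upto_def cst_def)

lemma var_in_polys_upto: "p < M \<Longrightarrow> var (Suc p) \<in> polys_upto M"
  by (simp add: polys_upto_def var_def)

lemma polys_upto_mono: "M \<le> N \<Longrightarrow> polys_upto M \<subseteq> polys_upto N"
  unfolding polys_upto_def by fastforce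

lemma polys_upto_add: "f \<in> polys_upto M \<Longrightarrow> g \<in> polys_upto M \<Longrightarrow> f + g \<in> polys_upto M"
  unfolding polys_upto_def using keys_add[of f g] by blast

lemma polys_upto_mult:
  assumes "f \<in> polys_upto M" "g \<in> polys_upto M"
  shows "f * g \<in> polys_upto M"
  unfolding polys_upto_def
proof (intro CollectI ballI)
  fix m assume "m \<in> Poly_Mapping.keys (f * g)"
  then obtain a b where *: "m = a + b" "a \<in> Poly_Mapping.keys f" "b \<in> Poly_Mapping.keys g"
    using keys_mult[of f g] by blast
  then have "Poly_Mapping.keys a \<subseteq> {..<M}" "Poly_Mapping.keys b \<subseteq> {..<M}"
    using assms by (auto simp: polys_upto_def)
  then show "Poly_Mapping.keys m \<subseteq> {..<M}" using keys_add[of a b] * by blast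
qed

lemma subring_polys_upto: "subring_set (polys_upto M :: 'k::comm_ring_1 sym_witt set)"
  unfolding subring_set_def
proof (intro conjI ballI polys_upto_add polys_upto_mult)
  show "0 \<in> (polys_upto M :: 'k sym_witt set)" by (simp add: polys_upto_def)
  show "1 \<in> (polys_upto M :: 'k sym_witt set)"
    using cst_in_polys_upto[of 1] by (simp add: cst_one)
qed (simp add: polys_upto_def)

lemma polys_upto_induct [consumes 1, case_names zero add_single]:
  assumes "f \<in> polys_upto M"
    and "P 0"
    and "\<And>f m c. P f \<Longrightarrow> Poly_Mapping.keys m \<subseteq> {..<M} \<Longrightarrow> P (f + Poly_Mapping.single m c)"
  shows "P f"
  using assms(1)
proof (induction f rule: update_induct)
  case const
  show ?case by (rule assms(2))
next
  case (update g k v)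
  have eq: "Poly_Mapping.update k v g = g + Poly_Mapping.single k v"
    using update
    by (intro poly_mapping_eqI)
      (auto simp: lookup_update lookup_add lookup_single when_def in_keys_iff)
  have "Poly_Mapping.keys (Poly_Mapping.update k v g) = insert k (Poly_Mapping.keys g)"
    using update by (auto simp: in_keys_iff lookup_update split: if_splits)
  then show ?case using update assms(3)[of g k v] by (simp add: eq polys_upto_def)
qed

lemma noetherian_polys_upto_0:
  "noetherian_subring (polys_upto 0 :: 'k::field sym_witt set)"
  unfolding noetherian_subring_def
proof (intro allI impI)
  fix I :: "'k sym_witt set" assume I: "ideal_of_subring (polys_upto 0) I"
  have scalar: "\<exists>c. f = cst c" if "f \<in> polys_upto 0" for f :: "'k sym_witt"
  proof
    have "Poly_Mapping.keys f \<subseteq> {0}" using that by (auto simp: polys_upto_def)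
    then show "f = cst (Poly_Mapping.lookup f 0)"
      unfolding cst_def
      by (intro poly_mapping_eqI) (auto simp: lookup_single when_def in_keys_iff subset_iff)
  qed
  show "\<exists>H. finite H \<and> H \<subseteq> I \<and> (\<forall>K. ideal_of_subring (polys_upto 0) K \<and> H \<subseteq> K \<longrightarrow> I \<subseteq> K)"
  proof (cases "I \<subseteq> {0}")
    case True
    then show ?thesis by (intro exI[of _ "{}"]) (auto simp: ideal_of_subring_def)
  next
    case False
    then obtain f where f: "f \<in> I" "f \<noteq> 0" by blast
    have "I \<subseteq> polys_upto 0" using I by (simp add: ideal_of_subring_def)
    then obtain c where c: "f = cst c" using scalar f by blast
    then have "c \<noteq> 0" using f by (auto simp: cst_def)
    have "I \<subseteq> K" if K: "ideal_of_subring (polys_upto 0) K" "f \<in> K" for K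
    proof
      fix g assume "g \<in> I"
      then obtain a where "g = cst a" using scalar \<open>I \<subseteq> polys_upto 0\<close> by blast
      then have "g = cst (a / c) * f" using c \<open>c \<noteq> 0\<close> by (simp add: cst_mult_cst)
      then show "g \<in> K" using K by (simp add: ideal_of_subring_def cst_in_polys_upto)
    qed
    then show ?thesis using f by (intro exI[of _ "{f}"]) auto
  qed
qed

lemma var_power: "var (Suc p) ^ d = Poly_Mapping.single (Poly_Mapping.single p d) 1"
  by (induction d) (simp_all add: var_def mult_single flip: single_add)

text \<open>The only new variable sits at position \<open>M\<close> and is
  \<open>var (Suc M)\<close>; splitting its power off each monomial leaves a coefficient in
  \<open>polys_upto M\<close>.\<close>

lemma polys_upto_Suc_subset:
  "polys_upto (Suc M) \<subseteq> (\<Union>d. polys_below (polys_upto M) (var (Suc M)) d)"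
proof
  fix f :: "'a sym_witt"
  let ?U = "\<Union>d. polys_below (polys_upto M) (var (Suc M) :: 'a sym_witt) d"
  note A = subring_polys_upto[of M, where 'k='a]
  have add: "p + q \<in> ?U" if "p \<in> ?U" "q \<in> ?U" for p q
  proof -
    from that obtain d e where "p \<in> polys_below (polys_upto M) (var (Suc M)) d"
      "q \<in> polys_below (polys_upto M) (var (Suc M)) e" by blast
    then have "p + q \<in> polys_below (polys_upto M) (var (Suc M)) (max d e)"
      using polys_below_mono[OF A, of d "max d e"] polys_below_mono[OF A, of e "max d e"]
      by (intro polys_below_add[OF A]) auto
    then show ?thesis by (rule UN_I[OF UNIV_I])
  qed
  have single: "Poly_Mapping.single m c \<in> ?U" if m: "Poly_Mapping.keys m \<subseteq> {..<Suc M}"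
    for m and c :: 'a
  proof -
    define d where "d = Poly_Mapping.lookup m M"
    define a where "a = Poly_Mapping.single (m - Poly_Mapping.single M d) c"
    have "m = (m - Poly_Mapping.single M d) + Poly_Mapping.single M d"
      by (intro poly_mapping_eqI)
        (simp add: lookup_add lookup_minus lookup_single when_def d_def)
    then have "Poly_Mapping.single m c = a * var (Suc M) ^ d + 0"
      by (simp add: var_power a_def mult_single)
    moreover have "Poly_Mapping.keys (m - Poly_Mapping.single M d) \<subseteq> {..<M}"
    proof
      fix i assume "i \<in> Poly_Mapping.keys (m - Poly_Mapping.single M d)"
      then have "i \<in> Poly_Mapping.keys m" "i \<noteq> M"
        by (auto simp: in_keys_iff lookup_minus lookup_single when_def d_def)
      then show "i \<in> {..<M}" using m by force
    qed
    then have "a \<in> polys_upto M" by (simp add: a_def polys_upto_def)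
    ultimately have "Poly_Mapping.single m c \<in> polys_below (polys_upto M) (var (Suc M)) (Suc d)"
      using polys_below_zero[OF A, of "var (Suc M)" d] by (simp only: polys_below.simps) blast
    then show ?thesis by (rule UN_I[OF UNIV_I])
  qed
  assume "f \<in> polys_upto (Suc M)"
  then show "f \<in> ?U"
  proof (induction rule: polys_upto_induct)
    case zero
    show ?case by (rule UN_I[OF UNIV_I]) (rule polys_below_zero[OF A])
  next
    case (add_single f m c)
    show ?case by (intro add single add_single)
  qed
qed

lemma noetherian_polys_upto: "noetherian_subring (polys_upto M :: 'k::field sym_witt set)"
proof (induction M)
  case 0
  show ?case by (rule noetherian_polys_upto_0)
next
  case (Suc M)
  have "polys_upto M \<subseteq> (polys_upto (Suc M) :: 'k sym_witt set)"
    by (simp add: polys_upto_mono)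
  moreover have "var (Suc M) \<in> (polys_upto (Suc M) :: 'k sym_witt set)"
    by (simp add: var_in_polys_upto)
  ultimately show ?case
    by (rule hilbert_basis_subring[OF subring_polys_upto Suc subring_polys_upto
          _ _ polys_upto_Suc_subset])
qed

section \<open>Partial derivatives\<close>

text \<open>The index is a position: this is the derivative with respect to x_{n+1}.\<close>

definition partial :: "nat \<Rightarrow> 'k::comm_ring_1 sym_witt \<Rightarrow> 'k sym_witt" where
  "partial n = deriv_of (\<lambda>i. if i = n then 1 else 0)"

lemma lookup_cst_mult: "Poly_Mapping.lookup (cst c * f) m = c * Poly_Mapping.lookup f m"
  by (induction f rule: poly_single_induct)
    (auto simp: ring_distribs lookup_add cst_def mult_single lookup_single when_def)

lemma partial_single:
  "partial n (Poly_Mapping.single m c) =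
     cst c * (of_nat (Poly_Mapping.lookup m n) * Poly_Mapping.single (m - Poly_Mapping.single n 1) 1)"
  unfolding partial_def deriv_of_single
  by (subst mon_deriv_superset[of "insert n (Poly_Mapping.keys m)"])
    (auto simp: if_distrib[of "\<lambda>x. _ * x"] cong: if_cong)

lemma partial_add: "partial n (f + g) = partial n f + partial n g"
  by (simp add: partial_def deriv_of_add)

lemma lookup_of_nat_mult:
  fixes f :: "'k::comm_ring_1 sym_witt"
  shows "Poly_Mapping.lookup (of_nat k * f) m = of_nat k * Poly_Mapping.lookup f m"
  by (induction k) (simp_all add: ring_distribs lookup_add)

text \<open>No cancellation occurs between monomials: each coefficient of the derivative comes from
  a single coefficient of \<open>f\<close>. Bounds on variables and degree, and the use of
  characteristic zero, are read off from this.\<close>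

lemma lookup_partial:
  "Poly_Mapping.lookup (partial n f) m
     = of_nat (Suc (Poly_Mapping.lookup m n)) * Poly_Mapping.lookup f (m + Poly_Mapping.single n 1)"
proof (induction f rule: poly_single_induct)
  case zero
  show ?case by (simp add: partial_def)
next
  case (add_single f k c)
  have "Poly_Mapping.lookup (partial n (Poly_Mapping.single k c)) m
     = of_nat (Suc (Poly_Mapping.lookup m n))
       * Poly_Mapping.lookup (Poly_Mapping.single k c) (m + Poly_Mapping.single n 1)"
  proof (cases "k = m + Poly_Mapping.single n 1")
    case True
    then show ?thesis
      by (simp add: partial_single lookup_cst_mult lookup_of_nat_mult lookup_add mult.commute[of c] del: of_nat_Suc)
  next
    case False
    \<comment> \<open>Subtraction of exponent vectors is truncated, so it can be undone only if the
      exponent at \<open>n\<close> is positive; otherwise the derivative of the monomial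
      vanishes.\<close>
    have "k - Poly_Mapping.single n 1 \<noteq> m" if "Poly_Mapping.lookup k n \<noteq> 0"
    proof
      assume "k - Poly_Mapping.single n 1 = m"
      then have "k = m + Poly_Mapping.single n 1"
        using that
        by (intro poly_mapping_eqI) (auto simp: lookup_add lookup_minus lookup_single when_def)
      then show False using False by blast
    qed
    then show ?thesis using False
      by (cases "Poly_Mapping.lookup k n = 0")
        (simp_all add: partial_single lookup_cst_mult lookup_of_nat_mult lookup_single when_def)
  qed
  then show ?case using add_single by (simp only: partial_add lookup_add distrib_left)
qed

text \<open>This chain rule is what expresses brackets through partial derivatives.\<close>

lemma deriv_of_eq_sum_partial:
  assumes "f \<in> polys_upto M"
  shows "deriv_of \<phi> f = (\<Sum>i<M. \<phi> i * partial i f)"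
  using assms
proof (induction rule: polys_upto_induct)
  case zero
  show ?case by (simp add: partial_def)
next
  case (add_single f m c)
  have "deriv_of \<phi> (Poly_Mapping.single m c)
      = (\<Sum>i<M. \<phi> i * partial i (Poly_Mapping.single m c))"
    unfolding deriv_of_single partial_single
      mon_deriv_superset[OF finite_lessThan add_single(2)] sum_distrib_left
    by (intro sum.cong refl) (simp only: mult_ac)
  then show ?case using add_single(1)
    by (simp only: deriv_of_add partial_add distrib_left sum.distrib)
qed

lemma partial_in_polys_upto:
  assumes "f \<in> polys_upto M"
  shows "partial n f \<in> polys_upto M"
  unfolding polys_upto_def
proof (intro CollectI ballI)
  fix m assume "m \<in> Poly_Mapping.keys (partial n f)"
  then have "m + Poly_Mapping.single n 1 \<in> Poly_Mapping.keys f"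
    by (auto simp: in_keys_iff lookup_partial)
  then have "Poly_Mapping.keys (m + Poly_Mapping.single n 1) \<subseteq> {..<M}"
    using assms by (auto simp: polys_upto_def)
  then show "Poly_Mapping.keys m \<subseteq> {..<M}"
    by (auto simp: in_keys_iff lookup_add subset_iff)
qed

section \<open>Total degree and the existence of a separant outside a proper ideal\<close>

definition total_degree_le :: "nat \<Rightarrow> 'k::comm_ring_1 sym_witt \<Rightarrow> bool" where
  "total_degree_le d f \<longleftrightarrow>
     (\<forall>m\<in>Poly_Mapping.keys f. (\<Sum>i\<in>Poly_Mapping.keys m. Poly_Mapping.lookup m i) \<le> d)"

lemma ex_total_degree_le: "\<exists>d. total_degree_le d f"
proof
  show "total_degree_le (\<Sum>m\<in>Poly_Mapping.keys f. \<Sum>i\<in>Poly_Mapping.keys m. Poly_Mapping.lookup m i) f"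
    unfolding total_degree_le_def by (intro ballI member_le_sum) auto
qed

lemma sum_lookup_superset:
  fixes m :: "nat \<Rightarrow>\<^sub>0 nat"
  assumes "finite A" "Poly_Mapping.keys m \<subseteq> A"
  shows "(\<Sum>i\<in>Poly_Mapping.keys m. Poly_Mapping.lookup m i) = (\<Sum>i\<in>A. Poly_Mapping.lookup m i)"
  by (rule sum.mono_neutral_left) (use assms in \<open>auto simp: in_keys_iff\<close>)

lemma sum_lookup_add_single:
  fixes m :: "nat \<Rightarrow>\<^sub>0 nat"
  shows "(\<Sum>i\<in>Poly_Mapping.keys (m + Poly_Mapping.single n 1). Poly_Mapping.lookup (m + Poly_Mapping.single n 1) i)
     = Suc (\<Sum>i\<in>Poly_Mapping.keys m. Poly_Mapping.lookup m i)"
proof -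
  let ?A = "insert n (Poly_Mapping.keys m)"
  have "Poly_Mapping.keys (m + Poly_Mapping.single n 1) \<subseteq> ?A"
    using keys_add[of m "Poly_Mapping.single n 1"] by auto
  then have "(\<Sum>i\<in>Poly_Mapping.keys (m + Poly_Mapping.single n 1). Poly_Mapping.lookup (m + Poly_Mapping.single n 1) i)
    = (\<Sum>i\<in>?A. Poly_Mapping.lookup m i + Poly_Mapping.lookup (Poly_Mapping.single n 1) i)"
    by (subst sum_lookup_superset[of ?A]) (auto simp: lookup_add)
  also have "\<dots> = (\<Sum>i\<in>?A. Poly_Mapping.lookup m i) + (\<Sum>i\<in>?A. if i = n then 1 else 0)"
    by (simp only: sum.distrib) (simp add: lookup_single when_def eq_commute)
  also have "(\<Sum>i\<in>?A. if i = n then 1 else (0::nat)) = 1" by (simp add: sum.delta del: sum.insert)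
  also have "(\<Sum>i\<in>?A. Poly_Mapping.lookup m i) = (\<Sum>i\<in>Poly_Mapping.keys m. Poly_Mapping.lookup m i)"
    by (rule sum_lookup_superset[symmetric]) auto
  finally show ?thesis by simp
qed

lemma total_degree_le_partial: "total_degree_le (Suc d) f \<Longrightarrow> total_degree_le d (partial n f)"
  unfolding total_degree_le_def
proof
  fix m assume f: "\<forall>m\<in>Poly_Mapping.keys f. (\<Sum>i\<in>Poly_Mapping.keys m. Poly_Mapping.lookup m i) \<le> Suc d"
    and "m \<in> Poly_Mapping.keys (partial n f)"
  then have "m + Poly_Mapping.single n 1 \<in> Poly_Mapping.keys f"
    by (auto simp: in_keys_iff lookup_partial)
  then show "(\<Sum>i\<in>Poly_Mapping.keys m. Poly_Mapping.lookup m i) \<le> d"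
    using f sum_lookup_add_single[of m n] by fastforce
qed

lemma total_degree_le_0: "total_degree_le 0 f \<Longrightarrow> f = cst (Poly_Mapping.lookup f 0)"
proof (rule poly_mapping_eqI)
  fix m assume "total_degree_le 0 f"
  then have "m = 0" if "m \<in> Poly_Mapping.keys f"
    using that by (intro poly_mapping_eqI) (auto simp: total_degree_le_def in_keys_iff)
  then show "Poly_Mapping.lookup f m = Poly_Mapping.lookup (cst (Poly_Mapping.lookup f 0)) m"
    by (auto simp: cst_def lookup_single when_def in_keys_iff)
qed

lemma ex_polys_upto: "\<exists>M. f \<in> polys_upto M"
proof -
  have "finite (\<Union>m\<in>Poly_Mapping.keys f. Poly_Mapping.keys m)" by simp
  then obtain M where "(\<Union>m\<in>Poly_Mapping.keys f. Poly_Mapping.keys m) \<subseteq> {..<M}"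
    unfolding finite_nat_set_iff_bounded by blast
  then show ?thesis unfolding polys_upto_def by blast
qed

text \<open>In characteristic zero the integer factor in \<open>lookup_partial\<close> is nonzero,
  so a monomial containing x_{n+1} would leave a nonzero term in the derivative.\<close>

lemma polys_upto_partial_eq_0:
  fixes f :: "'k::field_char_0 sym_witt"
  assumes "f \<in> polys_upto (Suc n)" "partial n f = 0"
  shows "f \<in> polys_upto n"
  unfolding polys_upto_def
proof (intro CollectI ballI)
  fix m assume m: "m \<in> Poly_Mapping.keys f"
  have "Poly_Mapping.lookup m n = 0"
  proof (rule ccontr)
    assume "Poly_Mapping.lookup m n \<noteq> 0"
    then have eq: "m = (m - Poly_Mapping.single n 1) + Poly_Mapping.single n 1"
      by (intro poly_mapping_eqI) (auto simp: lookup_add lookup_minus lookup_single when_def)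
    have "Poly_Mapping.lookup (partial n f) (m - Poly_Mapping.single n 1) \<noteq> 0"
      using m by (simp only: lookup_partial eq[symmetric]) (simp add: in_keys_iff del: of_nat_Suc)
    then show False using assms by simp
  qed
  moreover have "Poly_Mapping.keys m \<subseteq> {..<Suc n}" using assms m by (auto simp: polys_upto_def)
  ultimately show "Poly_Mapping.keys m \<subseteq> {..<n}"
    by (metis in_keys_iff lessThan_Suc subset_insert)
qed

text \<open>If all these derivatives stayed in \<open>J\<close>, induction on the degree would make
  every element of \<open>J\<close> zero; the induction ends at constants, and a proper ideal
  contains no nonzero constant.\<close>

lemma ex_separant_notin:
  fixes J :: "'k::field_char_0 sym_witt set"
  assumes J: "is_ideal J" "1 \<notin> J" and f: "f \<in> J" "f \<noteq> 0"
  shows "\<exists>g\<in>J. \<exists>n. g \<in> polys_upto (Suc n) \<and> partial n g \<notin> J"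
proof (rule ccontr)
  assume neg: "\<not> (\<exists>g\<in>J. \<exists>n. g \<in> polys_upto (Suc n) \<and> partial n g \<notin> J)"
  have const: "g = 0" if "g \<in> J" "g = cst c" for g c
  proof (rule ccontr)
    assume "g \<noteq> 0"
    then have "c \<noteq> 0" using that by (auto simp: cst_def)
    then have "cst (1 / c) * g = 1" using that by (simp add: cst_mult_cst cst_one)
    then show False using J \<open>g \<in> J\<close> unfolding is_ideal_def by metis
  qed
  have "g = 0" if "g \<in> J" "total_degree_le d g" for g d
    using that
  proof (induction d arbitrary: g)
    case 0
    show ?case by (rule const[OF 0(1) total_degree_le_0[OF 0(2)]])
  next
    case (Suc d)
    note IH = Suc.IH and gJ = Suc.prems(1) and deg = Suc.prems(2)
    \<comment> \<open>Inner induction on the number of variables: the derivative by the last one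
      lies in \<open>J\<close> with a smaller degree bound, so it is zero and that variable does not
      occur in \<open>g\<close>.\<close>
    have "g \<in> polys_upto M \<Longrightarrow> g = 0" for M
    proof (induction M)
      case 0
      have "total_degree_le 0 g"
        using 0 by (auto simp: total_degree_le_def polys_upto_def)
      then show ?case by (intro const[OF gJ total_degree_le_0])
    next
      case (Suc n)
      have "partial n g \<in> J" using neg gJ Suc.prems by blast
      then have "partial n g = 0"
        by (rule IH[OF _ total_degree_le_partial[OF deg]])
      then show ?case by (intro Suc.IH polys_upto_partial_eq_0[OF Suc.prems])
    qed
    then show ?case using ex_polys_upto by blast
  qed
  then show False using f ex_total_degree_le by blast
qed

section \<open>Radical Poisson ideals\<close>

definition rad_poisson :: "'k::field_char_0 sym_witt set \<Rightarrow> bool" where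
  "rad_poisson J \<longleftrightarrow> is_poisson_ideal J \<and> is_radical_ideal J"

lemma rad_poissonI:
  assumes "0 \<in> J" "\<And>f g. f \<in> J \<Longrightarrow> g \<in> J \<Longrightarrow> f + g \<in> J" "\<And>r f. f \<in> J \<Longrightarrow> r * f \<in> J"
    and "\<And>f g. f \<in> J \<Longrightarrow> witt_bracket f g \<in> J" "\<And>f n. n \<ge> 1 \<Longrightarrow> f ^ n \<in> J \<Longrightarrow> f \<in> J"
  shows "rad_poisson J"
proof -
  have "f \<in> ideal_radical J" if "f \<in> J" for f
    unfolding ideal_radical_def using that by (intro CollectI exI[of _ 1]) simp
  moreover have "f \<in> J" if "f \<in> ideal_radical J" for f
    using that assms(5) by (auto simp: ideal_radical_def)
  ultimately have "J = ideal_radical J" by (intro equalityI subsetI)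
  then show ?thesis
    using assms(1-4)
    by (simp add: rad_poisson_def is_poisson_ideal_def is_radical_ideal_def is_ideal_def)
qed

context
  fixes J :: "'k::field_char_0 sym_witt set"
  assumes J: "rad_poisson J"
begin

lemma rad_poisson_ideal: "is_ideal J"
  using J by (simp add: rad_poisson_def is_poisson_ideal_def)

lemma rad_poisson_zero: "0 \<in> J"
  using rad_poisson_ideal by (simp add: is_ideal_def)

lemma rad_poisson_add: "f \<in> J \<Longrightarrow> g \<in> J \<Longrightarrow> f + g \<in> J"
  using rad_poisson_ideal by (simp add: is_ideal_def)

lemma rad_poisson_mult: "f \<in> J \<Longrightarrow> r * f \<in> J"
  using rad_poisson_ideal by (simp add: is_ideal_def)

lemma rad_poisson_mult_right: "f \<in> J \<Longrightarrow> f * r \<in> J"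
  using rad_poisson_mult[of f r] by (simp only: mult.commute)

lemma rad_poisson_diff: "f \<in> J \<Longrightarrow> g \<in> J \<Longrightarrow> f - g \<in> J"
  using rad_poisson_add[of f "- 1 * g"] rad_poisson_mult[of g "- 1"] by simp

lemma rad_poisson_bracket: "f \<in> J \<Longrightarrow> witt_bracket f g \<in> J"
  using J by (simp add: rad_poisson_def is_poisson_ideal_def)

lemma rad_poisson_root:
  assumes "n \<ge> 1" "f ^ n \<in> J"
  shows "f \<in> J"
proof -
  have "J = ideal_radical J" using J by (simp add: rad_poisson_def is_radical_ideal_def)
  moreover have "f \<in> ideal_radical J" using assms unfolding ideal_radical_def by blast
  ultimately show ?thesis by simp
qed

lemma rad_poisson_square: "f * f \<in> J \<Longrightarrow> f \<in> J"
  using rad_poisson_root[of 2 f] by (simp add: power2_eq_square)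

end

lemma witt_bracket_mult1: "witt_bracket (f * g) h = witt_bracket f h * g + f * witt_bracket g h"
  by (simp add: witt_bracket_eq_expl witt_bracket_expl_def deriv_of_mult)

text \<open>Closure under the bracket uses that \<open>J\<close> is radical: the Leibniz rule shows
  only that the square of \<open>witt_bracket f g * t\<close> lies in \<open>J\<close>.\<close>

lemma rad_poisson_colon:
  assumes J: "rad_poisson J"
  shows "rad_poisson {g. g * t \<in> J}"
proof (rule rad_poissonI)
  show "0 \<in> {g. g * t \<in> J}" using rad_poisson_zero[OF J] by simp
next
  fix f g assume "f \<in> {g. g * t \<in> J}" "g \<in> {g. g * t \<in> J}"
  then show "f + g \<in> {g. g * t \<in> J}" by (simp add: distrib_right rad_poisson_add[OF J])
next
  fix r f assume "f \<in> {g. g * t \<in> J}"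
  then show "r * f \<in> {g. g * t \<in> J}" by (simp add: mult.assoc rad_poisson_mult[OF J])
next
  fix f g assume "f \<in> {g. g * t \<in> J}"
  then have f: "f * t \<in> J" by simp
  let ?b = "witt_bracket f g * t"
  have eq: "?b * ?b = witt_bracket (f * t) g * ?b - f * t * (witt_bracket t g * witt_bracket f g)"
    unfolding witt_bracket_mult1 by (simp add: algebra_simps)
  have "?b * ?b \<in> J"
    unfolding eq
    by (rule rad_poisson_diff[OF J rad_poisson_mult_right[OF J rad_poisson_bracket[OF J f]]
          rad_poisson_mult_right[OF J f]])
  then have "?b \<in> J" by (rule rad_poisson_square[OF J])
  then show "witt_bracket f g \<in> {g. g * t \<in> J}" by simp
next
  fix f n assume n: "n \<ge> (1::nat)" and "f ^ n \<in> {g. g * t \<in> J}"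
  then have f: "f ^ n * t \<in> J" by simp
  \<comment> \<open>Since \<open>n \<ge> 1\<close>, the power \<open>(f * t) ^ n\<close> is a
    multiple of \<open>f ^ n * t\<close>.\<close>
  have "t ^ n = t * t ^ (n - 1)" using n by (cases n) simp_all
  then have "(f * t) ^ n = f ^ n * t * t ^ (n - 1)"
    by (simp only: power_mult_distrib mult.assoc)
  then have "(f * t) ^ n \<in> J" by (simp only: rad_poisson_mult_right[OF J f])
  then have "f * t \<in> J" by (rule rad_poisson_root[OF J n])
  then show "f \<in> {g. g * t \<in> J}" by simp
qed

section \<open>Hulls, directed unions and finite generation\<close>

lemma rad_poisson_Inter: "(\<And>X. X \<in> C \<Longrightarrow> rad_poisson X) \<Longrightarrow> rad_poisson (\<Inter>C)"
proof (rule rad_poissonI)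
  fix f n assume "n \<ge> (1::nat)" "f ^ n \<in> \<Inter>C" and C: "\<And>X. X \<in> C \<Longrightarrow> rad_poisson X"
  then have "f \<in> X" if "X \<in> C" for X using that by (intro rad_poisson_root[OF C, of X n f]) auto
  then show "f \<in> \<Inter>C" by blast
qed (auto intro: rad_poisson_zero rad_poisson_add rad_poisson_mult rad_poisson_bracket)

lemma rad_poisson_hull: "rad_poisson (rad_poisson hull A)"
  by (rule hull_in) (rule rad_poisson_Inter, blast)

lemma rad_poisson_hull_minimal: "rad_poisson J \<Longrightarrow> A \<subseteq> J \<Longrightarrow> rad_poisson hull A \<subseteq> J"
  by (rule hull_minimal)

text \<open>Each closure condition involves at most two members, and directedness puts them into one
  set of \<open>C\<close>. It serves for Zorn chains, for hulls of finite subsets and for the final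
  ascending sequence.\<close>

lemma rad_poisson_directed_Union:
  assumes ne: "C \<noteq> {}" and C: "\<And>X. X \<in> C \<Longrightarrow> rad_poisson X"
    and dir: "\<And>X Y. X \<in> C \<Longrightarrow> Y \<in> C \<Longrightarrow> \<exists>Z\<in>C. X \<subseteq> Z \<and> Y \<subseteq> Z"
  shows "rad_poisson (\<Union>C)"
proof (rule rad_poissonI)
  show "0 \<in> \<Union>C" using ne C rad_poisson_zero by blast
next
  fix f g assume "f \<in> \<Union>C" "g \<in> \<Union>C"
  then obtain X Y where "X \<in> C" "f \<in> X" "Y \<in> C" "g \<in> Y" by blast
  then obtain Z where Z: "Z \<in> C" "f \<in> Z" "g \<in> Z" using dir[of X Y] by blast
  then have "f + g \<in> Z" by (intro rad_poisson_add[OF C])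
  then show "f + g \<in> \<Union>C" using Z by blast
next
  fix r f assume "f \<in> \<Union>C"
  then obtain X where X: "X \<in> C" "f \<in> X" by blast
  then have "r * f \<in> X" by (intro rad_poisson_mult[OF C])
  then show "r * f \<in> \<Union>C" using X by blast
next
  fix f g assume "f \<in> \<Union>C"
  then obtain X where X: "X \<in> C" "f \<in> X" by blast
  then have "witt_bracket f g \<in> X" by (intro rad_poisson_bracket[OF C])
  then show "witt_bracket f g \<in> \<Union>C" using X by blast
next
  fix f n assume n: "n \<ge> (1::nat)" and "f ^ n \<in> \<Union>C"
  then obtain X where X: "X \<in> C" "f ^ n \<in> X" by blast
  then have "f \<in> X" by (rule rad_poisson_root[OF C n])
  then show "f \<in> \<Union>C" using X by blast
qed

definition finitely_generated :: "'k::field_char_0 sym_witt set \<Rightarrow> bool" where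
  "finitely_generated J \<longleftrightarrow> (\<exists>F. finite F \<and> F \<subseteq> J \<and> J = rad_poisson hull F)"

text \<open>The hulls of finite subsets of \<open>A\<close> form a directed family, so their union
  is a radical Poisson ideal; it contains \<open>A\<close> and hence the hull of
  \<open>A\<close>.\<close>

lemma hull_finite_subset:
  assumes "f \<in> rad_poisson hull A"
  shows "\<exists>F. finite F \<and> F \<subseteq> A \<and> f \<in> rad_poisson hull F"
proof -
  let ?C = "{rad_poisson hull F |F. finite F \<and> F \<subseteq> A}"
  have "rad_poisson (\<Union>?C)"
  proof (rule rad_poisson_directed_Union)
    show "?C \<noteq> {}" by blast
    show "rad_poisson X" if "X \<in> ?C" for X using that rad_poisson_hull by blast
    fix X Y assume "X \<in> ?C" "Y \<in> ?C"
    then obtain F G where FG: "X = rad_poisson hull F" "Y = rad_poisson hull G"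
      "finite F" "finite G" "F \<subseteq> A" "G \<subseteq> A" by blast
    have "rad_poisson hull (F \<union> G) \<in> ?C" using FG by blast
    moreover have "X \<subseteq> rad_poisson hull (F \<union> G)" "Y \<subseteq> rad_poisson hull (F \<union> G)"
      unfolding FG by (intro hull_mono; blast)+
    ultimately show "\<exists>Z\<in>?C. X \<subseteq> Z \<and> Y \<subseteq> Z" by blast
  qed
  moreover have "A \<subseteq> \<Union>?C"
  proof
    fix a assume "a \<in> A"
    then have "rad_poisson hull {a} \<in> ?C" by blast
    moreover have "a \<in> rad_poisson hull {a}" by (rule hull_inc) simp
    ultimately show "a \<in> \<Union>?C" by blast
  qed
  ultimately have "rad_poisson hull A \<subseteq> \<Union>?C" by (rule rad_poisson_hull_minimal)
  then show ?thesis using assms by blast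
qed

text \<open>Generators can be chosen inside the given set \<open>A\<close>: each of the finitely
  many original generators already lies in the hull of a finite part of \<open>A\<close>.\<close>

lemma finitely_generated_hull:
  assumes "finitely_generated (rad_poisson hull A)"
  shows "\<exists>F. finite F \<and> F \<subseteq> A \<and> rad_poisson hull F = rad_poisson hull A"
proof -
  obtain G where G: "finite G" "G \<subseteq> rad_poisson hull A" "rad_poisson hull A = rad_poisson hull G"
    using assms unfolding finitely_generated_def by blast
  have "\<forall>g\<in>G. \<exists>F. finite F \<and> F \<subseteq> A \<and> g \<in> rad_poisson hull F"
    using G(2) by (intro ballI hull_finite_subset) (rule subsetD)
  from bchoice[OF this] obtain F where
    F': "\<forall>g\<in>G. finite (F g) \<and> F g \<subseteq> A \<and> g \<in> rad_poisson hull (F g)" ..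
  then have F: "\<And>g. g \<in> G \<Longrightarrow> finite (F g)" "\<And>g. g \<in> G \<Longrightarrow> F g \<subseteq> A"
    "\<And>g. g \<in> G \<Longrightarrow> g \<in> rad_poisson hull (F g)" by simp_all
  let ?F = "\<Union>g\<in>G. F g"
  have "G \<subseteq> rad_poisson hull ?F"
  proof
    fix g assume g: "g \<in> G"
    then have "rad_poisson hull (F g) \<subseteq> rad_poisson hull ?F" by (intro hull_mono) blast
    then show "g \<in> rad_poisson hull ?F" using F(3)[OF g] by blast
  qed
  then have "rad_poisson hull G \<subseteq> rad_poisson hull ?F"
    by (intro rad_poisson_hull_minimal rad_poisson_hull)
  moreover have "rad_poisson hull ?F \<subseteq> rad_poisson hull A"
    by (intro hull_mono) (use F(2) in blast)
  ultimately have "rad_poisson hull ?F = rad_poisson hull A" using G(3) by simp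
  moreover have "finite ?F" "?F \<subseteq> A" using G(1) F(1,2) by auto
  ultimately show ?thesis by (intro exI[of _ ?F] conjI)
qed

section \<open>Elimination of variables\<close>

text \<open>For \<open>s\<close> in \<open>polys_upto M\<close> these are the elements that become a
  polynomial in the first \<open>M\<close> variables divided by a power of \<open>s\<close>, once
  \<open>J\<close> is factored out and \<open>s\<close> is inverted.\<close>

definition finite_modulo ::
  "'k::field_char_0 sym_witt set \<Rightarrow> 'k sym_witt \<Rightarrow> nat \<Rightarrow> 'k sym_witt set" where
  "finite_modulo J s M = {g. \<exists>N. \<exists>h\<in>polys_upto M. s ^ N * g - h \<in> J}"

context
  fixes J :: "'k::field_char_0 sym_witt set" and s :: "'k sym_witt" and M :: nat
  assumes J: "rad_poisson J" and s: "s \<in> polys_upto M"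
begin

lemma power_in_polys_upto: "s ^ n \<in> polys_upto M"
proof (induction n)
  case 0
  show ?case using cst_in_polys_upto[of 1 M] by (simp add: cst_one)
next
  case (Suc n)
  then show ?case using s by (simp add: polys_upto_mult)
qed

lemma polys_upto_finite_modulo: "g \<in> polys_upto M \<Longrightarrow> g \<in> finite_modulo J s M"
  unfolding finite_modulo_def
  by (intro CollectI exI[of _ 0] bexI[of _ g]) (simp_all add: rad_poisson_zero[OF J])

lemma finite_modulo_add:
  assumes "f \<in> finite_modulo J s M" "g \<in> finite_modulo J s M"
  shows "f + g \<in> finite_modulo J s M"
proof -
  obtain m p n q where *: "p \<in> polys_upto M" "s ^ m * f - p \<in> J"
    "q \<in> polys_upto M" "s ^ n * g - q \<in> J"
    using assms unfolding finite_modulo_def by blast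
  have "s ^ n * (s ^ m * f - p) + s ^ m * (s ^ n * g - q) \<in> J"
    using * rad_poisson_add[OF J] rad_poisson_mult[OF J] by blast
  then have "s ^ (m + n) * (f + g) - (s ^ n * p + s ^ m * q) \<in> J"
    by (simp add: power_add algebra_simps)
  moreover have "s ^ n * p + s ^ m * q \<in> polys_upto M"
    by (intro polys_upto_add polys_upto_mult power_in_polys_upto *)
  ultimately show ?thesis unfolding finite_modulo_def by blast
qed

lemma finite_modulo_mult:
  assumes "f \<in> finite_modulo J s M" "g \<in> finite_modulo J s M"
  shows "f * g \<in> finite_modulo J s M"
proof -
  obtain m p n q where *: "p \<in> polys_upto M" "s ^ m * f - p \<in> J"
    "q \<in> polys_upto M" "s ^ n * g - q \<in> J"
    using assms unfolding finite_modulo_def by blast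
  have "(s ^ n * g) * (s ^ m * f - p) + p * (s ^ n * g - q) \<in> J"
    using * rad_poisson_add[OF J] rad_poisson_mult[OF J] by blast
  then have "s ^ (m + n) * (f * g) - p * q \<in> J"
    by (simp add: power_add algebra_simps)
  moreover have "p * q \<in> polys_upto M" by (intro polys_upto_mult *)
  ultimately show ?thesis unfolding finite_modulo_def by blast
qed

lemma finite_modulo_cong:
  assumes "f - g \<in> J" "g \<in> finite_modulo J s M"
  shows "f \<in> finite_modulo J s M"
proof -
  obtain n q where *: "q \<in> polys_upto M" "s ^ n * g - q \<in> J"
    using assms unfolding finite_modulo_def by blast
  have "s ^ n * (f - g) + (s ^ n * g - q) \<in> J"
    using * assms(1) rad_poisson_add[OF J] rad_poisson_mult[OF J] by blast
  then have "s ^ n * f - q \<in> J" by (simp add: algebra_simps)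
  then show ?thesis using * unfolding finite_modulo_def by blast
qed

lemma finite_modulo_cancel:
  assumes "s * f \<in> finite_modulo J s M"
  shows "f \<in> finite_modulo J s M"
proof -
  obtain n q where *: "q \<in> polys_upto M" "s ^ n * (s * f) - q \<in> J"
    using assms unfolding finite_modulo_def by blast
  then have "s ^ Suc n * f - q \<in> J" by (simp add: algebra_simps)
  then show ?thesis using * unfolding finite_modulo_def by blast
qed

lemma finite_modulo_cst: "cst c \<in> finite_modulo J s M"
  by (intro polys_upto_finite_modulo cst_in_polys_upto)

lemma finite_modulo_sum:
  "(\<And>i. i \<in> A \<Longrightarrow> f i \<in> finite_modulo J s M) \<Longrightarrow> sum f A \<in> finite_modulo J s M"
proof (induction A rule: infinite_finite_induct)
  case (insert i A)
  then show ?case by (simp add: finite_modulo_add)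
qed (use finite_modulo_cst[of 0] in \<open>simp_all add: cst_def\<close>)

end

text \<open>Positions are shifted by one against indices, so x_{i+1} and x_{j+1} bracket to a
  multiple of x_{i+j+2} with the factor \<open>j - i\<close>.\<close>

lemma witt_bracket_var_sum:
  assumes "f \<in> polys_upto M"
  shows "witt_bracket f (var (Suc j)) = (\<Sum>i<M. of_int (int j - int i) * var (i + j + 2) * partial i f)"
  using deriv_of_eq_sum_partial[OF assms]
  by (simp add: witt_bracket_eq_expl witt_bracket_expl_def deriv_of_var)

text \<open>For \<open>j > n\<close> the bracket of \<open>f\<close> with \<open>x\<^sub>j\<^sub>+\<^sub>1\<close> is, up to a nonzero scalar, \<open>s * x\<^sub>n\<^sub>+\<^sub>j\<^sub>+\<^sub>2\<close>
  plus terms in lower variables (\<open>s = partial n f\<close>), so inverting \<open>s\<close> eliminates all variables from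
  \<open>x\<^sub>2\<^sub>n\<^sub>+\<^sub>3\<close> on.\<close>

lemma finite_modulo_separant:
  fixes J :: "'k::field_char_0 sym_witt set"
  assumes J: "rad_poisson J" and f: "f \<in> J" "f \<in> polys_upto (Suc n)"
  shows "g \<in> finite_modulo J (partial n f) (2 * n + 2)"
proof -
  define s where "s = partial n f"
  let ?T = "finite_modulo J s (2 * n + 2)"
  have pf: "partial i f \<in> polys_upto (2 * n + 2)" for i
    using partial_in_polys_upto[OF f(2), of i] polys_upto_mono[of "Suc n" "2 * n + 2"] by auto
  then have s: "s \<in> polys_upto (2 * n + 2)" by (simp add: s_def)
  note T = polys_upto_finite_modulo[OF J s] finite_modulo_add[OF J s] finite_modulo_mult[OF J s]
    finite_modulo_cst[OF J s]
  have var: "var (Suc p) \<in> ?T" for p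
  proof (induction p rule: less_induct)
    case (less p)
    show ?case
    proof (cases "p < 2 * n + 2")
      case True
      then show ?thesis by (intro T(1) var_in_polys_upto)
    next
      case False
      \<comment> \<open>This choice makes \<open>var (Suc p)\<close> the variable
        \<open>var (n + j + 2)\<close> of the top term, and \<open>p \<ge> 2 * n + 2\<close> gives
        \<open>j > n\<close>, so the scalar \<open>j - n\<close> is nonzero.\<close>
      define j where "j = p - n - 1"
      have j: "j > n" "n + j + 1 = p" using False by (auto simp: j_def)
      define c where "c = (of_int (int j - int n) :: 'k)"
      have c: "c \<noteq> 0" using j by (simp add: c_def)
      define rest where "rest = (\<Sum>i<n. of_int (int j - int i) * var (i + j + 2) * partial i f)"
      have "witt_bracket f (var (Suc j)) = rest + cst c * var (Suc p) * s"
        using j by (simp add: witt_bracket_var_sum[OF f(2)] rest_def s_def c_def of_int_eq_cst)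
      then have "rest + cst c * var (Suc p) * s \<in> J"
        using rad_poisson_bracket[OF J f(1), of "var (Suc j)"] by simp
      then have "cst (1 / c) * (rest + cst c * var (Suc p) * s) \<in> J"
        by (rule rad_poisson_mult[OF J])
      also have "cst (1 / c) * (rest + cst c * var (Suc p) * s)
          = cst (1 / c) * rest + (cst (1 / c) * cst c) * (s * var (Suc p))"
        by (simp add: algebra_simps)
      also have "\<dots> = s * var (Suc p) - cst (- 1 / c) * rest"
      proof -
        have "cst (1 / c) + cst (- 1 / c) = (0 :: 'k sym_witt)"
          by (simp add: cst_def flip: single_add)
        then have "cst (1 / c) * rest = - (cst (- 1 / c) * rest)"
          by (simp only: eq_neg_iff_add_eq_0 mult_zero_left flip: distrib_right)
        moreover have "cst (1 / c) * cst c = (1 :: 'k sym_witt)"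
          using c by (simp add: cst_mult_cst cst_one)
        ultimately show ?thesis by simp
      qed
      finally have red: "s * var (Suc p) - cst (- 1 / c) * rest \<in> J" .
      have "rest \<in> ?T"
        unfolding rest_def
      proof (rule finite_modulo_sum[OF J s])
        fix i assume "i \<in> {..<n}"
        \<comment> \<open>The remaining terms involve only variables at smaller positions, to which
          the induction hypothesis applies.\<close>
        then have "i + j + 1 < p" using j by simp
        then have "var (i + j + 2) \<in> ?T" using less[of "i + j + 1"] by simp
        then show "of_int (int j - int i) * var (i + j + 2) * partial i f \<in> ?T"
          unfolding of_int_eq_cst by (intro T(3,4) T(1)[OF pf])
      qed
      then have "cst (- 1 / c) * rest \<in> ?T" by (rule T(3)[OF T(4)])
      then show ?thesis
        by (rule finite_modulo_cancel[OF J s finite_modulo_cong[OF J s red]])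
    qed
  qed
  have "g \<in> ?T"
  proof (induction g rule: sym_witt_induct)
    case (var i)
    then show ?case using \<open>\<And>p. var (Suc p) \<in> ?T\<close>[of "i - 1"] by simp
  qed (simp_all only: T(2-4))
  then show ?thesis by (simp add: s_def)
qed

section \<open>Finite generation\<close>

text \<open>Zorn's lemma applies because finitely many generators of the union of a chain would all
  lie in one member, which would then equal the union and be finitely generated.\<close>

lemma ex_non_finitely_generated_maximal:
  fixes J :: "'k::field_char_0 sym_witt set"
  assumes "rad_poisson J" "\<not> finitely_generated J"
  shows "\<exists>P :: 'k sym_witt set. rad_poisson P \<and> \<not> finitely_generated P
    \<and> (\<forall>Q. rad_poisson Q \<and> P \<subset> Q \<longrightarrow> finitely_generated Q)"
proof -
  let ?A = "{P :: 'k sym_witt set. rad_poisson P \<and> \<not> finitely_generated P}"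
  have "\<exists>P\<in>?A. \<forall>X\<in>?A. P \<subseteq> X \<longrightarrow> X = P"
  proof (rule subset_Zorn_nonempty)
    have "J \<in> ?A" using assms by simp
    then show "?A \<noteq> {}" by auto
    fix C assume ne: "C \<noteq> {}" and C: "subset.chain ?A C"
    have CA: "X \<in> ?A" if "X \<in> C" for X using C that by (auto simp: subset_chain_def)
    have total: "X \<subseteq> Y \<or> Y \<subseteq> X" if "X \<in> C" "Y \<in> C" for X Y
      using C that by (auto simp: subset_chain_def)
    have U: "rad_poisson (\<Union>C)"
    proof (rule rad_poisson_directed_Union[OF ne])
      show "rad_poisson X" if "X \<in> C" for X using CA[OF that] by simp
      show "\<exists>Z\<in>C. X \<subseteq> Z \<and> Y \<subseteq> Z" if "X \<in> C" "Y \<in> C" for X Y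
        using total[OF that] that by blast
    qed
    have "\<not> finitely_generated (\<Union>C)"
    proof
      assume "finitely_generated (\<Union>C)"
      then obtain F where F: "finite F" "F \<subseteq> \<Union>C" "\<Union>C = rad_poisson hull F"
        unfolding finitely_generated_def by blast
      obtain X where X: "X \<in> C" "F \<subseteq> X"
        by (rule finite_subset_Union_chain[OF F(1,2) ne C])
      then have "\<Union>C \<subseteq> X" using F(3) CA[OF X(1)] X(2) rad_poisson_hull_minimal[of X F] by simp
      then have "\<Union>C = X" using X(1) by (intro equalityI Union_upper)
      then have "X = rad_poisson hull F" using F(3) by simp
      then have "finitely_generated X"
        unfolding finitely_generated_def using F(1) X(2) by (intro exI[of _ F] conjI)
      then show False using CA[OF X(1)] by simp
    qed
    then show "\<Union>C \<in> ?A" using U by simp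
  qed
  then obtain P where P: "P \<in> ?A" "\<And>X. X \<in> ?A \<Longrightarrow> P \<subseteq> X \<Longrightarrow> X = P" by blast
  have "finitely_generated Q" if "rad_poisson Q" "P \<subset> Q" for Q
    using P(2)[of Q] that by auto
  then show ?thesis using P(1) by (intro exI[of _ P]) simp
qed

theorem rad_poisson_finitely_generated:
  fixes J :: "'k::field_char_0 sym_witt set"
  assumes "rad_poisson J"
  shows "finitely_generated J"
proof (rule ccontr)
  assume "\<not> finitely_generated J"
  from ex_non_finitely_generated_maximal[OF assms this]
  obtain P :: "'k sym_witt set" where P': "rad_poisson P \<and> \<not> finitely_generated P
    \<and> (\<forall>Q. rad_poisson Q \<and> P \<subset> Q \<longrightarrow> finitely_generated Q)" ..
  then have P: "rad_poisson P" and nfg: "\<not> finitely_generated P" by simp_all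
  from P' have max: "finitely_generated Q" if "rad_poisson Q" "P \<subset> Q" for Q
    using that by simp
  have fgI: "finitely_generated P" if "finite F" "F \<subseteq> P" "P \<subseteq> rad_poisson hull F" for F
    unfolding finitely_generated_def
    using that rad_poisson_hull_minimal[OF P that(2)]
    by (intro exI[of _ F] conjI equalityI)
  \<comment> \<open>The unit ideal and the zero ideal are finitely generated, so \<open>P\<close> is
    proper and nonzero, as \<open>ex_separant_notin\<close> requires.\<close>
  have "1 \<notin> P"
  proof
    assume "1 \<in> P"
    have "1 \<in> rad_poisson hull {1 :: 'k sym_witt}" by (rule hull_inc) simp
    then have "x \<in> rad_poisson hull {1}" for x :: "'k sym_witt"
      using rad_poisson_mult[OF rad_poisson_hull, of 1 "{1}" x] by simp
    then have "finitely_generated P" using \<open>1 \<in> P\<close> by (intro fgI[of "{1}"]) auto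
    then show False using nfg by simp
  qed
  have "\<not> P \<subseteq> {0}"
  proof
    assume "P \<subseteq> {0}"
    then have "finitely_generated P"
      using rad_poisson_zero[OF rad_poisson_hull, of "{}"] by (intro fgI[of "{}"]) auto
    then show False using nfg by simp
  qed
  then obtain f0 where "f0 \<in> P" "f0 \<noteq> 0" by blast
  from ex_separant_notin[OF rad_poisson_ideal[OF P] \<open>1 \<notin> P\<close> this]
  obtain f n where f: "f \<in> P" "f \<in> polys_upto (Suc n)" "partial n f \<notin> P" by blast
  define s where "s = partial n f"
  define M where "M = 2 * n + 2"

  have PM: "ideal_of_subring (polys_upto M) (P \<inter> polys_upto M)"
    using subring_polys_upto[of M, where 'k='k] rad_poisson_zero[OF P] rad_poisson_add[OF P]
      rad_poisson_mult[OF P]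
    by (auto simp: ideal_of_subring_def subring_set_def)
  \<comment> \<open>Hilbert's basis theorem provides ordinary ideal generators for the part of
    \<open>P\<close> in the first \<open>M\<close> variables.\<close>
  have "\<exists>H. finite H \<and> H \<subseteq> P \<inter> polys_upto M
      \<and> (\<forall>K. ideal_of_subring (polys_upto M) K \<and> H \<subseteq> K \<longrightarrow> P \<inter> polys_upto M \<subseteq> K)"
    using noetherian_polys_upto[of M, where 'k='k] PM by (simp only: noetherian_subring_def)
  then obtain H where H: "finite H \<and> H \<subseteq> P \<inter> polys_upto M
      \<and> (\<forall>K. ideal_of_subring (polys_upto M) K \<and> H \<subseteq> K \<longrightarrow> P \<inter> polys_upto M \<subseteq> K)" ..
  then have H1: "finite H" and H2: "H \<subseteq> P \<inter> polys_upto M" by simp_all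
  from H have H3: "P \<inter> polys_upto M \<subseteq> K"
    if "ideal_of_subring (polys_upto M) K" "H \<subseteq> K" for K
    using that by simp

  have "rad_poisson (rad_poisson hull (insert s P))" by (rule rad_poisson_hull)
  moreover have "P \<subset> rad_poisson hull (insert s P)"
    using hull_subset[of "insert s P" rad_poisson] f(3) unfolding s_def by blast
  ultimately have "finitely_generated (rad_poisson hull (insert s P))" by (rule max)
  \<comment> \<open>The generators are taken from \<open>insert s P\<close> itself, so removing
    \<open>s\<close> leaves a subset of \<open>P\<close>.\<close>
  from finitely_generated_hull[OF this] obtain G where G: "finite G" "G \<subseteq> insert s P"
    "rad_poisson hull G = rad_poisson hull (insert s P)" by blast

  \<comment> \<open>Here \<open>f\<close> serves to eliminate variables, \<open>H\<close> covers the
    elements of \<open>P\<close> in the first \<open>M\<close> variables, and \<open>G - {s}\<close>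
    covers the generators of the larger hull other than \<open>s\<close>.\<close>
  define F where "F = insert f (H \<union> (G - {s}))"
  define Q where "Q = rad_poisson hull F"
  have Q: "rad_poisson Q" unfolding Q_def by (rule rad_poisson_hull)
  have FQ: "F \<subseteq> Q" unfolding Q_def by (rule hull_subset)
  have FP: "F \<subseteq> P" using f(1) H2 G(2) by (auto simp: F_def)
  then have QP: "Q \<subseteq> P" unfolding Q_def by (rule rad_poisson_hull_minimal[OF P])
  have "ideal_of_subring (polys_upto M) (Q \<inter> polys_upto M)"
    using subring_polys_upto[of M, where 'k='k] rad_poisson_zero[OF Q] rad_poisson_add[OF Q]
      rad_poisson_mult[OF Q]
    by (auto simp: ideal_of_subring_def subring_set_def)
  moreover have "H \<subseteq> Q \<inter> polys_upto M" using H2 FQ by (simp add: F_def)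
  ultimately have PQ: "P \<inter> polys_upto M \<subseteq> Q \<inter> polys_upto M" by (rule H3)

  have sP: "s * p \<in> Q" if p: "p \<in> P" for p
  proof -
    have "f \<in> Q" using FQ by (simp add: F_def)
    \<comment> \<open>Elimination works modulo \<open>Q\<close> since \<open>f \<in> Q\<close>. The
      resulting \<open>h\<close> lies in \<open>P\<close> because \<open>Q \<subseteq> P\<close>,
      and then in \<open>Q\<close> because \<open>H\<close> generates that part of
      \<open>P\<close>.\<close>
    then have "p \<in> finite_modulo Q s M"
      unfolding s_def M_def by (rule finite_modulo_separant[OF Q _ f(2)])
    then obtain N h where h: "h \<in> polys_upto M" "s ^ N * p - h \<in> Q"
      unfolding finite_modulo_def by blast
    have "s ^ N * p - (s ^ N * p - h) \<in> P"
      by (rule rad_poisson_diff[OF P rad_poisson_mult[OF P p] subsetD[OF QP h(2)]])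
    then have "h \<in> Q" using PQ h(1) by auto
    from rad_poisson_add[OF Q h(2) this] have "s ^ N * p \<in> Q" by simp
    \<comment> \<open>The extra factor completes \<open>s ^ N * p\<close> to a power of
      \<open>s * p\<close>, whose root lies in the radical ideal \<open>Q\<close>.\<close>
    then have "(s * p ^ N) * (s ^ N * p) \<in> Q" by (rule rad_poisson_mult[OF Q])
    also have "(s * p ^ N) * (s ^ N * p) = (s * p) ^ Suc N"
      by (simp add: power_mult_distrib mult_ac)
    finally show ?thesis by (rule rad_poisson_root[OF Q, rotated]) simp
  qed
  have "P \<subseteq> Q"
  proof
    fix p assume p: "p \<in> P"
    have "g * p \<in> Q" if "g \<in> G" for g
    proof (cases "g = s")
      case False
      then have "g \<in> Q" using that FQ by (auto simp: F_def)
      then show ?thesis by (rule rad_poisson_mult_right[OF Q])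
    qed (use sP[OF p] in simp)
    \<comment> \<open>A colon ideal containing the generators contains their whole hull, and
      \<open>p\<close> itself belongs to that hull; this yields
      \<open>p * p \<in> Q\<close>.\<close>
    then have "rad_poisson hull G \<subseteq> {g. g * p \<in> Q}"
      by (intro rad_poisson_hull_minimal rad_poisson_colon[OF Q]) blast
    moreover have "p \<in> rad_poisson hull G" unfolding G(3) by (rule hull_inc) (simp add: p)
    ultimately have "p * p \<in> Q" by blast
    then show "p \<in> Q" by (rule rad_poisson_square[OF Q])
  qed
  moreover have "finite F" using H1 G(1) by (simp add: F_def)
  ultimately have "finitely_generated P" unfolding Q_def by (intro fgI[OF _ FP])
  then show False using nfg by simp
qed

text \<open>The union of the sequence is again a radical Poisson ideal, hence the hull of a finite
  set. That set already lies in some \<open>I N\<close>, so \<open>I N\<close> is the whole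
  union.\<close>

theorem theorem1p5:
  fixes I :: "nat \<Rightarrow> 'k::field_char_0 sym_witt set"
  assumes "\<And>n. is_poisson_ideal (I n)"
    and "\<And>n. is_radical_ideal (I n)"
    and "\<And>n. I n \<subseteq> I (Suc n)"
  shows "\<exists>N. \<forall>j\<ge>N. I j = I N"
proof -
  have mono: "m \<le> n \<Longrightarrow> I m \<subseteq> I n" for m n
    by (rule lift_Suc_mono_le[of I, OF assms(3)])
  have I: "rad_poisson (I n)" for n using assms(1,2) by (simp add: rad_poisson_def)
  have "rad_poisson (\<Union>(range I))"
  proof (rule rad_poisson_directed_Union)
    fix X Y assume "X \<in> range I" "Y \<in> range I"
    then obtain m n where "X = I m" "Y = I n" by blast
    then show "\<exists>Z\<in>range I. X \<subseteq> Z \<and> Y \<subseteq> Z"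
      using mono[of m "max m n"] mono[of n "max m n"] by auto
  qed (use I in auto)
  then have "finitely_generated (\<Union>(range I))" by (rule rad_poisson_finitely_generated)
  then obtain F where F: "finite F" "F \<subseteq> \<Union>(range I)" "\<Union>(range I) = rad_poisson hull F"
    unfolding finitely_generated_def by (elim exE conjE)
  have "\<exists>N. F \<subseteq> I N"
    using F(1,2)
  proof (induction F rule: finite_induct)
    case (insert h F)
    then obtain m n where "F \<subseteq> I m" "h \<in> I n" by auto
    then have "insert h F \<subseteq> I (max m n)"
      using mono[of m "max m n"] mono[of n "max m n"] by auto
    then show ?case by blast
  qed simp
  then obtain N where N: "F \<subseteq> I N" by blast
  have "\<Union>(range I) \<subseteq> I N" unfolding F(3) by (rule rad_poisson_hull_minimal[OF I N])
  then have "I j = I N" if "j \<ge> N" for j using mono[OF that] by blast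
  then show ?thesis by blast
qed

end
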